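(* Up to isomorphism, there are exactly two core trees with $16$ vertices that do not have a majority polymorphism, and every core tree with fewer than $16$ vertices has a majority polymorphism.
   Context: A digraph is a pair $\mathbb{H}=(H;E)$ with $H$ a nonempty finite set and $E\subseteq H^2$. A homomorphism from a digraph $\mathbb{G}$ to a digraph $\mathbb{H}$ is a map $h\colon G\to H$ such that $(h(x),h(y))\in E(\mathbb{H})$ for every $(x,y)\in E(\mathbb{G})$. A finite digraph is a core if every homomorphism from it to itself is injective. An orientation of an undirected graph is obtained by replacing each edge $\{x,y\}$ by exactly one of $(x,y)$, $(y,x)$. A "tree" means a digraph that is an orientation of a finite undirected tree (connected acyclic graph); a core tree is a tree that is a core. A $k$-ary polymorphism of $\mathbb{H}$ is a map $f\colon H^k\to H$ such that $(f(u_1,\dots,u_k),f(v_1,\dots,v_k))\in E(\mathbb{H})$ whenever $(u_1,v_1),\dots,(u_k,v_k)\in E(\mathbb{H})$. A majority polymorphism is a ternary polymorphism $f$ with $f(x,x,y)=f(x,y,x)=f(y,x,x)=x$ for all $x,y\in H$. *)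

theory Defs
  imports "Graph_Theory.Graph_Theory"
begin

definition digraph_hom ::
    "('a \<Rightarrow> 'b) \<Rightarrow> 'a pair_pre_digraph \<Rightarrow> 'b pair_pre_digraph \<Rightarrow> bool" where
  "digraph_hom h G H \<longleftrightarrow>
     (\<forall>x \<in> pverts G. h x \<in> pverts H) \<and>
     (\<forall>x y. (x, y) \<in> parcs G \<longrightarrow> (h x, h y) \<in> parcs H)"

definition core_digraph :: "'a pair_pre_digraph \<Rightarrow> bool" where
  "core_digraph G \<longleftrightarrow> (\<forall>h. digraph_hom h G G \<longrightarrow> inj_on h (pverts G))"

text \<open>
  An undirected graph is a finite, symmetric, loop-free digraph
  (\<^locale>\<open>pair_graph\<close>). The constants \<^const>\<open>forest\<close> and \<^const>\<open>tree\<close> of the library are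
  not usable for such graphs: \<^const>\<open>pre_digraph.cycle\<close> also admits the walk
  \<open>a, b, a\<close> along a single edge. In a symmetric loop-free digraph the cycles of the
  undirected graph are those of length at least 3. Connectedness includes
  nonemptiness of the vertex set.
\<close>

definition undirected_tree :: "'a pair_pre_digraph \<Rightarrow> bool" where
  "undirected_tree U \<longleftrightarrow>
     pair_graph U \<and> connected (with_proj U) \<and>
     \<not> (\<exists>c. pre_digraph.cycle (with_proj U) c \<and> length c \<ge> 3)"

definition orientation_of :: "'a pair_pre_digraph \<Rightarrow> 'a pair_pre_digraph \<Rightarrow> bool" where
  "orientation_of G U \<longleftrightarrow>
     pverts G = pverts U \<and> parcs G \<subseteq> parcs U \<and>
     (\<forall>x y. (x, y) \<in> parcs U \<longrightarrow> ((x, y) \<in> parcs G \<longleftrightarrow> (y, x) \<notin> parcs G))"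

definition oriented_tree :: "'a pair_pre_digraph \<Rightarrow> bool" where
  "oriented_tree G \<longleftrightarrow> (\<exists>U. undirected_tree U \<and> orientation_of G U)"

definition core_tree :: "'a pair_pre_digraph \<Rightarrow> bool" where
  "core_tree G \<longleftrightarrow> oriented_tree G \<and> core_digraph G"

text \<open>Elements of \<open>H\<^sup>k\<close> are lists of length \<open>k\<close> over the vertex set.\<close>

definition polymorphism :: "nat \<Rightarrow> 'a pair_pre_digraph \<Rightarrow> ('a list \<Rightarrow> 'a) \<Rightarrow> bool" where
  "polymorphism k H f \<longleftrightarrow>
     (\<forall>us. length us = k \<and> set us \<subseteq> pverts H \<longrightarrow> f us \<in> pverts H) \<and>
     (\<forall>us vs. length us = k \<and> length vs = k \<and> (\<forall>i<k. (us ! i, vs ! i) \<in> parcs H)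
        \<longrightarrow> (f us, f vs) \<in> parcs H)"

definition majority_polymorphism :: "'a pair_pre_digraph \<Rightarrow> ('a list \<Rightarrow> 'a) \<Rightarrow> bool" where
  "majority_polymorphism H f \<longleftrightarrow>
     polymorphism 3 H f \<and>
     (\<forall>x \<in> pverts H. \<forall>y \<in> pverts H.
        f [x, x, y] = x \<and> f [x, y, x] = x \<and> f [y, x, x] = x)"

definition has_majority :: "'a pair_pre_digraph \<Rightarrow> bool" where
  "has_majority H \<longleftrightarrow> (\<exists>f. majority_polymorphism H f)"

end

theory Submission
  imports Defs
begin

text \<open>
  A tree \<open>T\<close> is graded by levels. On triples \<open>(x, y, z)\<close> of one level, the median \<open>m\<close> of \<open>x, y, z\<close>
  in the undirected tree already behaves like a majority polymorphism as long as \<open>m\<close> is one of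
  \<open>x, y, z\<close>; otherwise \<open>x, y, z\<close> lie in three different branches (arms) at \<open>m\<close>, and a majority
  polymorphism is obtained as soon as, for every vertex \<open>c\<close> and every three arms at \<open>c\<close>, there is a
  function \<open>\<phi>\<close> on the triples from these arms that preserves edges and takes values adjacent to \<open>c\<close>
  where one of the coordinates can step to \<open>c\<close>.

  Two choices of \<open>\<phi>\<close> suffice almost always: either map level \<open>0\<close> (the level of \<open>c\<close>) to \<open>c\<close> and treat
  the levels above and below \<open>c\<close> separately, or project to one coordinate. Both fail only if each arm
  comes back to level \<open>0\<close> and leaves it again in a certain way. A core does not admit a folding of one
  branch at a vertex onto a neighbour; together with this, each of the three arms has at least 4
  vertices, hence at most 7 if \<open>T\<close> has at most 16. There are only 114 branches with at most 7
  vertices (up to isomorphism and the direction of the arc to the root) that admit no folding, and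
  examining all triples of them by computation leaves two trees, which are the reverses of each
  other.
\<close>

section \<open>Forest codes and the finite check\<close>

text \<open>The problem is local because a triple spread over three arms at \<open>c\<close> can
  leave them only through \<open>c\<close>: once a coordinate steps to \<open>c\<close>, the median
  of the new triple is \<open>c\<close>, and so is the prescribed value. Hence the functions \<phi>
  for different \<open>c\<close> never have to be compatible with one another. Foldings bound the
  enumeration in two ways: they exclude most branches, and they exclude equal siblings, so a child
  forest is a set and not a multiset of branches. The obstacle is that a tree has no canonical code,
  since siblings may be listed in any order. Codes are therefore used only through homomorphisms: a
  code that describes \<open>T\<close> exactly gives homomorphisms in both directions between
  \<open>T\<close> and a fixed tree with the same code, and between cores this already yields an
  isomorphism.\<close>

text \<open>
  A forest codes the rooted tree obtained by adding a root: \<open>B d s f\<close> has a first branch, whose top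
  vertex has the child forest \<open>s\<close>, followed by the branches of \<open>f\<close>. The flag \<open>d\<close> tells whether the
  arc to the top vertex points away from the root. A branch on its own is coded by \<open>(d, s)\<close>; it has
  \<open>sz s + 1\<close> vertices.
\<close>

datatype fo = E | B bool fo fo

fun sz :: "fo \<Rightarrow> nat" where
  "sz E = 0"
| "sz (B d s f) = Suc (sz s + sz f)"

fun app :: "fo \<Rightarrow> fo \<Rightarrow> fo" where
  "app E g = g"
| "app (B d s f) g = B d s (app f g)"

fun picks :: "fo \<Rightarrow> ((bool \<times> fo) \<times> fo) list" where
  "picks E = []"
| "picks (B d s f) = ((d, s), f) # map (\<lambda>(b, g). (b, B d s g)) (picks f)"

text \<open>
  \<open>rhom f R\<close>: the rooted tree \<open>f\<close> has a homomorphism to the unrooted tree \<open>R\<close> that maps root to root.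
  A step in \<open>R\<close> is a change of its root, so that walking back towards the old root needs no
  separate treatment.
\<close>

fun rhom :: "fo \<Rightarrow> fo \<Rightarrow> bool" where
  "rhom E R \<longleftrightarrow> True"
| "rhom (B d s f) R \<longleftrightarrow>
     list_ex (\<lambda>((e, u), g). d = e \<and> rhom s (B (\<not> d) g u)) (picks R) \<and> rhom f R"

text \<open>
  No branch of \<open>f\<close>, at any depth, folds onto a neighbour of its parent. The branches in \<open>acc\<close> are
  possible targets only: the siblings that were passed, and the branch containing the parent.
\<close>

fun foldfree :: "fo \<Rightarrow> fo \<Rightarrow> bool" where
  "foldfree E acc \<longleftrightarrow> True"
| "foldfree (B d s f) acc \<longleftrightarrow>
     list_all (\<lambda>((e, u), g). d = e \<longrightarrow> \<not> rhom s (B (\<not> d) (B d s g) u)) (picks (app f acc)) \<and>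
     foldfree s (B (\<not> d) (app f acc) E) \<and> foldfree f (B d s acc)"

text \<open>Every entry of \<open>bs\<close> is used at most once, because siblings with equal codes
  would fold onto each other. An entry \<open>b\<close> accounts for \<open>sz (snd b) + 1\<close>
  of the \<open>Suc m\<close> vertices, whence the test \<open>k \<le> m\<close>.\<close>

fun subs :: "nat \<Rightarrow> (bool \<times> fo) list \<Rightarrow> fo list" where
  "subs 0 bs = [E]"
| "subs (Suc m) [] = []"
| "subs (Suc m) (b # bs) =
     (let k = sz (snd b) in if k \<le> m then map (B (fst b) (snd b)) (subs (m - k) bs) else [])
     @ subs (Suc m) bs"

text \<open>\<open>branches m\<close> lists the branches with at most \<open>m\<close> vertices that are free of foldings.\<close>

fun branches :: "nat \<Rightarrow> (bool \<times> fo) list" where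
  "branches 0 = []"
| "branches (Suc m) = (let bs = branches m; fs = filter (\<lambda>f. foldfree f E) (subs m bs) in
     bs @ map (Pair True) fs @ map (Pair False) fs)"

text \<open>
  Let \<open>c\<close> be a vertex of level \<open>0\<close> and fix a side \<open>e\<close> of it, above or below; levels are counted
  positively towards this side. A part of an arm is a component of its vertices of positive level, and
  a contact is a vertex of level 1 with a neighbour of level 0. The label of a part records whether it contains the
  top vertex \<open>a\<close> of the arm (\<open>lroot\<close>), whether \<open>a\<close> is its only contact (\<open>lsingle\<close>), whether all
  neighbours of its contacts on level 0 are adjacent to \<open>a\<close> (\<open>lnear\<close>, a sufficient condition), and
  its largest level (\<open>lht\<close>).
\<close>

datatype lab = Lab (lroot: bool) (lsingle: bool) (lnear: bool) (lht: nat)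

text \<open>
  In the functions below \<open>n\<close> stands for the level \<open>n + 1\<close> of the root of the forest, except in
  \<open>lab_lo\<close>, where it stands for the level \<open>- n\<close>.
\<close>

fun hgt :: "bool \<Rightarrow> nat \<Rightarrow> fo \<Rightarrow> nat" where
  "hgt e n E = Suc n"
| "hgt e n (B d s f) =
     max (if d = e then hgt e (Suc n) s else case n of 0 \<Rightarrow> 0 | Suc m \<Rightarrow> hgt e m s) (hgt e n f)"

fun contact :: "bool \<Rightarrow> nat \<Rightarrow> fo \<Rightarrow> bool" where
  "contact e n E \<longleftrightarrow> False"
| "contact e n (B d s f) \<longleftrightarrow>
     (if d = e then contact e (Suc n) s else case n of 0 \<Rightarrow> True | Suc m \<Rightarrow> contact e m s)
     \<or> contact e n f"

text \<open>\<open>lab_hi\<close> runs inside a part whose label is already known and lists only the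
  parts reached after leaving it. The flag \<open>nf\<close> of \<open>lab_lo\<close> tells that the
  root of the forest is a neighbour of the top vertex \<open>a\<close> on level 0; a part entered
  from there is near if the arc of entry is its only connection to level 0.\<close>

fun lab_hi :: "bool \<Rightarrow> nat \<Rightarrow> fo \<Rightarrow> lab list"
  and lab_lo :: "bool \<Rightarrow> nat \<Rightarrow> bool \<Rightarrow> fo \<Rightarrow> lab list" where
  "lab_hi e n E = []"
| "lab_hi e n (B d s f) =
     (if d = e then lab_hi e (Suc n) s
      else case n of 0 \<Rightarrow> lab_lo e 0 False s | Suc m \<Rightarrow> lab_hi e m s) @ lab_hi e n f"
| "lab_lo e n nf E = []"
| "lab_lo e n nf (B d s f) =
     (if d = e then
        (case n of 0 \<Rightarrow> Lab False False (nf \<and> \<not> contact e 0 s) (hgt e 0 s) # lab_hi e 0 s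
         | Suc m \<Rightarrow> lab_lo e m False s)
      else lab_lo e (Suc n) False s) @ lab_lo e n nf f"

text \<open>Steps from the top vertex itself down to level 0 are not counted, so the negation says
  that the part of the top vertex has no other contact.\<close>

fun top_contact :: "bool \<Rightarrow> fo \<Rightarrow> bool" where
  "top_contact e E \<longleftrightarrow> False"
| "top_contact e (B d s f) \<longleftrightarrow> (d = e \<and> contact e 1 s) \<or> top_contact e f"

fun lab_top :: "bool \<Rightarrow> fo \<Rightarrow> lab list" where
  "lab_top e E = []"
| "lab_top e (B d s f) = (if d = e then lab_hi e 1 s else lab_lo e 0 True s) @ lab_top e f"

fun labs :: "bool \<Rightarrow> bool \<times> fo \<Rightarrow> lab list" where
  "labs e (d, s) =
     (if d = e then Lab True (\<not> top_contact e s) False (hgt e 0 s) # lab_top e s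
      else lab_lo e 1 False s)"

fun dheight :: "bool \<Rightarrow> fo \<Rightarrow> nat" where
  "dheight e E = 0"
| "dheight e (B d s f) = max (if d = e then Suc (dheight e s) else 0) (dheight e f)"

definition star3 :: "bool \<times> fo \<Rightarrow> bool \<times> fo \<Rightarrow> bool \<times> fo \<Rightarrow> fo" where
  "star3 a b c = B (fst a) (snd a) (B (fst b) (snd b) (B (fst c) (snd c) E))"

text \<open>
  \<open>zcond\<close> is the condition for sending level 0 to \<open>c\<close>, where \<open>h\<close> is the length of the longest directed path
  from \<open>c\<close>, and \<open>qcond\<close> the one for projecting to the first coordinate.
\<close>

definition zcond :: "nat \<Rightarrow> lab \<Rightarrow> lab \<Rightarrow> lab \<Rightarrow> bool" where
  "zcond h k l m \<longleftrightarrow> lsingle k \<or> lsingle l \<or> lsingle m \<or> lht k \<le> h \<or> lht l \<le> h \<or> lht m \<le> h"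

definition qcond :: "lab \<Rightarrow> lab \<Rightarrow> lab \<Rightarrow> bool" where
  "qcond k l m \<longleftrightarrow> \<not> lroot l \<and> \<not> lroot m \<or> lsingle k \<or>
     lnear k \<and> (lht k \<le> 1 \<or> lht l \<le> 1 \<or> lht m \<le> 1)"

definition all3 :: "('l \<Rightarrow> 'l \<Rightarrow> 'l \<Rightarrow> bool) \<Rightarrow> 'l list \<Rightarrow> 'l list \<Rightarrow> 'l list \<Rightarrow> bool" where
  "all3 P ks ls ms \<longleftrightarrow> list_all (\<lambda>k. list_all (\<lambda>l. list_all (P k l) ms) ls) ks"

definition zgood :: "bool \<times> fo \<Rightarrow> bool \<times> fo \<Rightarrow> bool \<times> fo \<Rightarrow> bool \<Rightarrow> bool" where
  "zgood a b c e \<longleftrightarrow> all3 (zcond (dheight e (star3 a b c))) (labs e a) (labs e b) (labs e c)"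

definition qgood :: "bool \<times> fo \<Rightarrow> bool \<times> fo \<Rightarrow> bool \<times> fo \<Rightarrow> bool \<Rightarrow> bool" where
  "qgood a b c e \<longleftrightarrow> all3 qcond (labs e a) (labs e b) (labs e c)"

text \<open>Conditionals instead of connectives make the simplifier evaluate \<open>good\<close>, \<open>settled\<close> and
  \<open>settled0\<close> lazily.\<close>

definition good :: "bool \<times> fo \<Rightarrow> bool \<times> fo \<Rightarrow> bool \<times> fo \<Rightarrow> bool" where
  "good a b c \<longleftrightarrow>
     (if (if zgood a b c True then zgood a b c False else False) then True
      else if (if qgood a b c True then qgood a b c False else False) then True
      else if (if qgood b a c True then qgood b a c False else False) then True
      else if qgood c a b True then qgood c a b False else False)"

text \<open>
  If three arms of a core are not \<open>good\<close>, then there is a side \<open>e\<close> such that either one of them starts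
  on side \<open>e\<close>, so that a neighbour of \<open>c\<close> there is available as a target for foldings, and all three
  satisfy \<open>arm1 e\<close>, or all three satisfy \<open>arm0 e\<close>.
\<close>

definition arm1 :: "bool \<Rightarrow> bool \<times> fo \<Rightarrow> bool" where
  "arm1 e a \<longleftrightarrow> list_ex (\<lambda>l. \<not> lsingle l \<and> 1 < lht l) (labs e a) \<and>
     foldfree (snd a) (B (\<not> fst a) (B e E E) E)"

definition arm0 :: "bool \<Rightarrow> bool \<times> fo \<Rightarrow> bool" where
  "arm0 e a \<longleftrightarrow> fst a \<noteq> e \<and> list_ex (\<lambda>l. \<not> lsingle l) (labs e a) \<and> list_ex (\<lambda>l. \<not> lsingle l) (labs (\<not> e) a)"

fun pairs2 :: "('b \<Rightarrow> 'b \<Rightarrow> bool) \<Rightarrow> 'b list \<Rightarrow> bool" where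
  "pairs2 P [] \<longleftrightarrow> True"
| "pairs2 P (x # xs) \<longleftrightarrow> list_all (P x) xs \<and> pairs2 P xs"

fun trip3 :: "('b \<Rightarrow> 'b \<Rightarrow> 'b \<Rightarrow> bool) \<Rightarrow> 'b list \<Rightarrow> bool" where
  "trip3 P [] \<longleftrightarrow> True"
| "trip3 P (x # xs) \<longleftrightarrow> pairs2 (P x) xs \<and> trip3 P xs"

text \<open>
  The first entry is the tree without a majority polymorphism. The second one is no core, but only
  a branch containing the centre folds.
\<close>

definition exceptional :: "bool \<Rightarrow> fo list" where
  "exceptional e = (if e then
    [star3 (True, B False (B False E (B True (B True E E) E)) E)
       (False, B False E (B True (B True (B True E E) E) E))
       (False, B True (B True (B True (B True E E) E) E) E),
     star3 (False, B True (B True (B True E E) E) E)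
       (True, B False (B False E (B True (B True E E) E)) E)
       (False, B False (B True (B True (B True (B True E E) E) E) E) E)]
   else
    [star3 (True, B True E (B False (B False (B False E E) E) E))
       (True, B False (B False (B False (B False E E) E) E) E)
       (False, B True (B True E (B False (B False E E) E)) E),
     star3 (True, B False (B False (B False E E) E) E)
       (False, B True (B True E (B False (B False E E) E)) E)
       (True, B True (B False (B False (B False (B False E E) E) E) E) E)])"

text \<open>The bound 15 is 16 without the centre. For triples satisfying \<open>arm0\<close>,
  neither foldings nor exceptions come up, whence the simpler \<open>settled0\<close>.\<close>

definition settled :: "bool \<Rightarrow> bool \<times> fo \<Rightarrow> bool \<times> fo \<Rightarrow> bool \<times> fo \<Rightarrow> bool" where
  "settled e a b c \<longleftrightarrow>
     (if sz (star3 a b c) \<le> 15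
      then if (if fst a = e then True else if fst b = e then True else fst c = e)
        then if good a b c then True
          else if foldfree (star3 a b c) E then star3 a b c \<in> set (exceptional e) else True
        else True
      else True)"

definition settled0 :: "bool \<times> fo \<Rightarrow> bool \<times> fo \<Rightarrow> bool \<times> fo \<Rightarrow> bool" where
  "settled0 a b c \<longleftrightarrow> (if sz (star3 a b c) \<le> 15 then good a b c else True)"

section \<open>Oriented trees\<close>

definition dr :: "('v \<times> 'v) set \<Rightarrow> bool \<Rightarrow> 'v \<Rightarrow> 'v \<Rightarrow> bool" where
  "dr A d x y \<longleftrightarrow> (if d then (x, y) \<in> A else (y, x) \<in> A)"

lemma dr_Not [simp]: "dr A (\<not> d) x y \<longleftrightarrow> dr A d y x"
  by (simp add: dr_def)

text \<open>\<open>lo A w f\<close>: the rooted tree \<open>f\<close> has a homomorphism to \<open>A\<close> that maps its root to \<open>w\<close>.\<close>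

fun lo :: "('v \<times> 'v) set \<Rightarrow> 'v \<Rightarrow> fo \<Rightarrow> bool" where
  "lo A w E \<longleftrightarrow> True"
| "lo A w (B d s f) \<longleftrightarrow> (\<exists>u. dr A d w u \<and> lo A u s) \<and> lo A w f"

definition adjr :: "('v \<times> 'v) set \<Rightarrow> 'v \<Rightarrow> 'v \<Rightarrow> bool" where
  "adjr A x y \<longleftrightarrow> (x, y) \<in> A \<or> (y, x) \<in> A"

text \<open>Acyclicity has the form that suits branches: removing \<open>v\<close> separates its
  neighbours, so the branches at \<open>v\<close> are disjoint, while \<open>conn\<close> makes them
  cover everything else. The absence of cycles enters only through
  \<open>tree_acyclic\<close>.\<close>

locale otree =
  fixes V :: "'a set" and A :: "('a \<times> 'a) set"
  assumes fin: "finite V" and ne: "V \<noteq> {}" and AV: "A \<subseteq> V \<times> V"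
    and asym: "(x, y) \<in> A \<Longrightarrow> (y, x) \<notin> A"
    and conn: "x \<in> V \<Longrightarrow> y \<in> V \<Longrightarrow> (x, y) \<in> {(x, y). adjr A x y}\<^sup>*"
    and acyc: "adjr A v w \<Longrightarrow> adjr A v w' \<Longrightarrow>
      (w, w') \<in> {(x, y). adjr A x y \<and> x \<noteq> v \<and> y \<noteq> v}\<^sup>* \<Longrightarrow> w = w'"
begin

abbreviation "adj \<equiv> adjr A"

definition nb :: "'a \<Rightarrow> 'a set" where "nb w = {u. adj w u}"

text \<open>\<open>S v w\<close> is the vertex set of the branch at \<open>v\<close> that contains the neighbour \<open>w\<close>, and \<open>U w X\<close> consists
  of \<open>w\<close> and its branches at the neighbours in \<open>X\<close>.\<close>

definition S :: "'a \<Rightarrow> 'a \<Rightarrow> 'a set" where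
  "S v w = {x. (w, x) \<in> {(x, y). adj x y \<and> x \<noteq> v \<and> y \<noteq> v}\<^sup>*}"

definition U :: "'a \<Rightarrow> 'a set \<Rightarrow> 'a set" where
  "U w X = insert w (\<Union>u\<in>X. S w u)"

lemma adj_sym: "adj x y \<longleftrightarrow> adj y x"
  by (auto simp: adjr_def)

lemma adj_neq: "adj x y \<Longrightarrow> x \<noteq> y"
  using asym by (auto simp: adjr_def)

lemma adj_V: "adj x y \<Longrightarrow> x \<in> V \<and> y \<in> V"
  using AV by (auto simp: adjr_def)

lemma dr_adj: "dr A d x y \<Longrightarrow> adj x y"
  by (auto simp: dr_def adjr_def split: if_splits)

lemma dr_V: "dr A d x y \<Longrightarrow> x \<in> V \<and> y \<in> V"
  using adj_V dr_adj by blast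

lemma adj_dr: "adj x y \<Longrightarrow> \<exists>d. dr A d x y"
  by (auto simp: dr_def adjr_def intro: exI[of _ True] exI[of _ False])

lemma nb_V: "nb w \<subseteq> V"
  using adj_V by (auto simp: nb_def)

lemma S_self [simp]: "w \<in> S v w"
  by (simp add: S_def)

lemma S_step: "x \<in> S v w \<Longrightarrow> adj x y \<Longrightarrow> x \<noteq> v \<Longrightarrow> y \<noteq> v \<Longrightarrow> y \<in> S v w"
  unfolding S_def by (auto intro: rtrancl_into_rtrancl)

lemma S_notin: assumes "w \<noteq> v" shows "v \<notin> S v w"
proof
  assume "v \<in> S v w"
  then have "(w, v) \<in> {(x, y). adj x y \<and> x \<noteq> v \<and> y \<noteq> v}\<^sup>*" by (simp add: S_def)
  then show False using assms by (cases rule: rtranclE) auto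
qed

lemma S_induct [consumes 1, case_names base step]:
  assumes "x \<in> S v w" and "P w"
    and "\<And>x y. x \<in> S v w \<Longrightarrow> P x \<Longrightarrow> adj x y \<Longrightarrow> x \<noteq> v \<Longrightarrow> y \<noteq> v \<Longrightarrow> P y"
  shows "P x"
proof -
  have "(w, x) \<in> {(x, y). adj x y \<and> x \<noteq> v \<and> y \<noteq> v}\<^sup>*" using assms(1) by (simp add: S_def)
  then show ?thesis
  proof (induction rule: rtrancl_induct)
    case base then show ?case using assms(2) .
  next
    case (step y z)
    then have "y \<in> S v w" "adj y z" "y \<noteq> v" "z \<noteq> v" by (auto simp: S_def)
    then show ?case using assms(3) step.IH by blast
  qed
qed

lemma S_sub: "w \<in> V \<Longrightarrow> S v w \<subseteq> V"
proof
  fix x assume "w \<in> V" "x \<in> S v w"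
  from this(2,1) show "x \<in> V" by (induction rule: S_induct) (auto dest: adj_V)
qed

lemma S_sym: assumes "x \<in> S v w" shows "w \<in> S v x"
proof -
  have "sym ({(x, y). adj x y \<and> x \<noteq> v \<and> y \<noteq> v}\<^sup>*)"
    by (rule sym_rtrancl) (auto simp: sym_def adj_sym)
  then show ?thesis using assms by (auto simp: S_def sym_def)
qed

lemma S_trans: "x \<in> S v w \<Longrightarrow> y \<in> S v x \<Longrightarrow> y \<in> S v w"
  by (auto simp: S_def)

lemma S_uniq: assumes "adj v w" "adj v w'" "x \<in> S v w" "x \<in> S v w'" shows "w = w'"
proof -
  have "w' \<in> S v w" using assms(3) S_sym[OF assms(4)] by (rule S_trans)
  then show ?thesis using acyc assms(1,2) by (auto simp: S_def)
qed

lemma S_cover: assumes "x \<in> V" "v \<in> V" "x \<noteq> v" shows "\<exists>w. adj v w \<and> x \<in> S v w"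
proof -
  have "(x, v) \<in> {(x, y). adjr A x y}\<^sup>*" using conn assms by blast
  then have "x = v \<or> (\<exists>w. adj v w \<and> x \<in> S v w)"
  proof (induction rule: converse_rtrancl_induct)
    case base then show ?case by simp
  next
    case (step x y)
    then have xy: "adj x y" by simp
    show ?case
    proof (cases "x = v \<or> y = v")
      case True then show ?thesis using xy adj_sym S_self by blast
    next
      case False
      then obtain w where "adj v w" "y \<in> S v w" using step by blast
      then show ?thesis using False xy S_step[of y v w x] adj_sym by blast
    qed
  qed
  then show ?thesis using assms by simp
qed

lemma S_decomp: assumes "adj v w" shows "S v w = U w (nb w - {v})"
proof
  show "S v w \<subseteq> U w (nb w - {v})"
  proof
    fix x assume "x \<in> S v w"
    then show "x \<in> U w (nb w - {v})"
    proof (induction rule: S_induct)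
      case base then show ?case by (simp add: U_def)
    next
      case (step x y)
      show ?case
      proof (cases "x = w \<or> y = w")
        case True
        then show ?thesis using step by (auto simp: U_def nb_def intro: S_self)
      next
        case False
        then obtain u where "u \<in> nb w - {v}" "x \<in> S w u" using step by (auto simp: U_def)
        then show ?thesis using False step S_step[of x w u y] by (auto simp: U_def)
      qed
    qed
  qed
next
  show "U w (nb w - {v}) \<subseteq> S v w"
  proof
    fix x assume "x \<in> U w (nb w - {v})"
    moreover have "x \<in> S v w" if u: "adj w u" "u \<noteq> v" and x: "x \<in> S w u" for u
      using x
    proof (induction rule: S_induct)
      case base
      show ?case using S_step[OF S_self, of w u v] u assms adj_neq by blast
    next
      case (step x y)
      have "y \<noteq> v"
      proof
        assume "y = v"
        then have "v \<in> S w u" using step S_step by blast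
        then show False using S_uniq[of w u v v] u assms adj_sym by auto
      qed
      moreover have "x \<noteq> v" using step.IH S_notin[of w v] adj_neq[OF assms] by auto
      ultimately show ?case using step S_step by blast
    qed
    ultimately show "x \<in> S v w" by (auto simp: U_def nb_def)
  qed
qed

lemma V_decomp: assumes "c \<in> V" shows "V = U c (nb c)"
proof
  show "V \<subseteq> U c (nb c)"
    using S_cover[OF _ assms] by (auto simp: U_def nb_def)
  show "U c (nb c) \<subseteq> V"
    using S_sub adj_V assms unfolding U_def nb_def by blast
qed

lemma U_remove: "u \<in> X \<Longrightarrow> U w X = U w (X - {u}) \<union> S w u"
  by (auto simp: U_def)

lemma U_empty [simp]: "U w {} = {w}"
  by (simp add: U_def)

lemma U_self [simp]: "w \<in> U w X"
  by (simp add: U_def)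

lemma U_disj: assumes "X \<subseteq> nb w" "u \<in> X" "x \<in> S w u" shows "x \<notin> U w (X - {u})"
proof
  assume "x \<in> U w (X - {u})"
  moreover have "u \<noteq> w" using assms adj_neq by (auto simp: nb_def)
  then have "x \<noteq> w" using assms S_notin by blast
  ultimately obtain u' where "u' \<in> X - {u}" "x \<in> S w u'" by (auto simp: U_def)
  then show False using S_uniq[of w u u' x] assms by (auto simp: nb_def)
qed

lemma U_cross:
  assumes "X \<subseteq> nb w" "u \<in> X" "x \<in> S w u" "y \<in> U w (X - {u})" "adj x y"
  shows "x = u \<and> y = w"
proof -
  have uw: "adj w u" "u \<noteq> w" using assms adj_neq by (auto simp: nb_def)
  have xw: "x \<noteq> w" using assms(3) S_notin uw by blast
  have "y = w"
  proof (rule ccontr)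
    assume "y \<noteq> w"
    then have "y \<in> S w u" using S_step assms xw by blast
    then show False using U_disj assms by blast
  qed
  then show ?thesis using S_uniq[of w x u x] assms(3,5) uw adj_sym by auto
qed

lemma U_sub: "w \<in> V \<Longrightarrow> X \<subseteq> nb w \<Longrightarrow> U w X \<subseteq> V"
  using S_sub nb_V unfolding U_def by blast

lemma finite_U: "w \<in> V \<Longrightarrow> X \<subseteq> nb w \<Longrightarrow> finite (U w X)"
  by (rule finite_subset[OF U_sub fin])

lemma card_U_remove: assumes "w \<in> V" "X \<subseteq> nb w" "u \<in> X"
  shows "card (U w X) = card (U w (X - {u})) + card (S w u)"
proof -
  have "U w (X - {u}) \<inter> S w u = {}" using U_disj assms by blast
  moreover have "finite (U w (X - {u}))" "finite (S w u)"
    using finite_U[of w X] assms by (auto simp: U_remove[OF assms(3)])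
  ultimately show ?thesis using U_remove[OF assms(3)] by (simp add: card_Un_disjoint)
qed

lemma S_card_pos: "w \<in> V \<Longrightarrow> 0 < card (S v w)"
  using finite_subset[OF S_sub fin, of w v] S_self[of w v] by (metis card_gt_0_iff empty_iff)

section \<open>Directions in a tree\<close>

text \<open>The neighbour of \<open>v\<close> in the direction of \<open>x\<close>, with the convention \<open>tow v v = v\<close>.\<close>

definition tow :: "'a \<Rightarrow> 'a \<Rightarrow> 'a" where
  "tow v x = (if x = v then v else (THE w. adj v w \<and> x \<in> S v w))"

lemma tow_self [simp]: "tow v v = v"
  by (simp add: tow_def)

lemma tow_eqI: assumes "adj v w" "x \<in> S v w" shows "tow v x = w"
proof -
  have "x \<noteq> v" using assms S_notin adj_neq by metis
  then show ?thesis unfolding tow_def using assms S_uniq by (auto intro!: the_equality)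
qed

lemma tow_props: assumes "x \<in> V" "v \<in> V" "x \<noteq> v"
  shows "adj v (tow v x)" "x \<in> S v (tow v x)"
  using S_cover[OF assms] tow_eqI by auto

lemma tow_adj: "adj v x \<Longrightarrow> tow v x = x"
  by (rule tow_eqI) auto

lemma tow_neq: "x \<in> V \<Longrightarrow> v \<in> V \<Longrightarrow> x \<noteq> v \<Longrightarrow> tow v x \<noteq> v"
  using tow_props adj_neq by metis

lemma tow_step: assumes "adj p q" "p \<noteq> c" "q \<noteq> c" "c \<in> V" shows "tow c p = tow c q"
proof -
  have "p \<in> V" using adj_V assms by blast
  note t = tow_props[OF this assms(4,2)]
  then have "q \<in> S c (tow c p)" using S_step assms by blast
  then show ?thesis using t tow_eqI by metis
qed

text \<open>The branch at \<open>m\<close> that contains \<open>z\<close> avoids \<open>y\<close>.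
  It can be traversed from \<open>m\<close> without meeting \<open>y\<close>, so seen from
  \<open>y\<close> all of it lies in the direction of \<open>m\<close>.\<close>

lemma tow_other: assumes "m \<in> V" "y \<in> V" "z \<in> V" "y \<noteq> m" "tow m z \<noteq> tow m y"
  shows "tow y z = tow y m"
proof (cases "z = m")
  case True then show ?thesis by simp
next
  case False
  let ?w = "tow m z"
  note w = tow_props[OF assms(3,1) False]
  note t = tow_props[OF assms(1,2) assms(4)[symmetric]]
  have yn: "y \<notin> S m ?w" using assms(5) tow_eqI[OF w(1), of y] by auto
  have "x \<in> S y (tow y m)" if "x \<in> S m ?w" for x using that
  proof (induction rule: S_induct)
    case base
    have "?w \<noteq> y" using yn by (metis S_self)
    then show ?case using S_step[OF t(2) w(1)] assms(4) by auto
  next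
    case (step x x')
    then have "x' \<in> S m ?w" using S_step by blast
    then show ?case using step yn S_step[of x y "tow y m" x'] by metis
  qed
  then show ?thesis using w(2) t(1) tow_eqI by blast
qed

text \<open>\<open>brs w X f\<close>: the forest \<open>f\<close> codes exactly the branches at \<open>w\<close> with top vertices in \<open>X\<close>.\<close>

fun brs :: "'a \<Rightarrow> 'a set \<Rightarrow> fo \<Rightarrow> bool" where
  "brs w X E \<longleftrightarrow> X = {}"
| "brs w X (B d s f) \<longleftrightarrow>
     (\<exists>u\<in>X. dr A d w u \<and> brs u (nb u - {w}) s \<and> brs w (X - {u}) f)"

lemma brs_ex: assumes "w \<in> V" "X \<subseteq> nb w" shows "\<exists>f. brs w X f"
  using assms
proof (induction "card (U w X)" arbitrary: w X rule: less_induct)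
  case less
  show ?case
  proof (cases "X = {}")
    case True then show ?thesis using brs.simps(1) by blast
  next
    case False
    then obtain u where u: "u \<in> X" by blast
    then have uw: "adj w u" using less by (auto simp: nb_def)
    have c: "card (U w X) = card (U w (X - {u})) + card (S w u)"
      using card_U_remove u less by blast
    have "u \<in> V" using uw adj_V by blast
    have "0 < card (U w (X - {u}))" using finite_U[of w "X - {u}"] less
      by (metis Diff_subset U_self card_gt_0_iff empty_iff subset_trans)
    moreover have "S w u = U u (nb u - {w})" using S_decomp uw by blast
    ultimately obtain s where s: "brs u (nb u - {w}) s"
      using less(1)[of u "nb u - {w}"] c \<open>u \<in> V\<close> by auto
    have "card (U w (X - {u})) < card (U w X)" using c S_card_pos \<open>u \<in> V\<close> by simp
    then obtain f where f: "brs w (X - {u}) f" using less by blast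
    obtain d where "dr A d w u" using adj_dr uw by blast
    then have "brs w X (B d s f)" using u s f by auto
    then show ?thesis by blast
  qed
qed

lemma brs_card: "brs w X f \<Longrightarrow> w \<in> V \<Longrightarrow> X \<subseteq> nb w \<Longrightarrow> card (U w X) = Suc (sz f)"
proof (induction f arbitrary: w X)
  case E then show ?case by simp
next
  case (B d s f)
  then obtain u where u: "u \<in> X" "dr A d w u" "brs u (nb u - {w}) s" "brs w (X - {u}) f" by auto
  then have uw: "adj w u" "u \<in> V" using dr_adj dr_V by blast+
  have "card (S w u) = Suc (sz s)" using B.IH(1)[OF u(3)] S_decomp[OF uw(1)] uw by auto
  moreover have "card (U w (X - {u})) = Suc (sz f)" using B.IH(2)[OF u(4)] B.prems by auto
  ultimately show ?case using card_U_remove[OF B.prems(2,3) u(1)] by simp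
qed

lemma brs_lo: "brs w X f \<Longrightarrow> lo A w f"
  by (induction f arbitrary: w X) auto

text \<open>Partial homomorphisms glue, since the only edge between the branch at \<open>u\<close>
  and the rest is the one joining \<open>u\<close> and \<open>w\<close>. The target is arbitrary:
  the integers for levels, the tree itself for foldings, another tree for the final
  comparison.\<close>

lemma hom_lo:
  assumes "brs w X f" "X \<subseteq> nb w" "lo A' w' f" "w' \<in> V'" and A': "A' \<subseteq> V' \<times> V'"
  shows "\<exists>h. h w = w' \<and> (\<forall>x\<in>U w X. h x \<in> V') \<and>
    (\<forall>x\<in>U w X. \<forall>y\<in>U w X. (x, y) \<in> A \<longrightarrow> (h x, h y) \<in> A')"
  using assms(1-4)
proof (induction f arbitrary: w X w')
  case E
  then show ?case using asym by (intro exI[of _ "\<lambda>_. w'"]) auto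
next
  case (B d s f)
  from B.prems(1) obtain u where u: "u \<in> X" "dr A d w u" "brs u (nb u - {w}) s" "brs w (X - {u}) f"
    by auto
  from B.prems(3) obtain u' where u': "dr A' d w' u'" "lo A' u' s" by auto
  have uw: "adj w u" using u dr_adj by blast
  have u'V: "u' \<in> V'" using u'(1) A' by (auto simp: dr_def split: if_splits)
  obtain h1 where h1: "h1 u = u'" "\<forall>x\<in>S w u. h1 x \<in> V'"
    "\<forall>x\<in>S w u. \<forall>y\<in>S w u. (x, y) \<in> A \<longrightarrow> (h1 x, h1 y) \<in> A'"
    using B.IH(1)[OF u(3) _ u'(2) u'V] S_decomp[OF uw] by auto
  obtain h2 where h2: "h2 w = w'" "\<forall>x\<in>U w (X - {u}). h2 x \<in> V'"
    "\<forall>x\<in>U w (X - {u}). \<forall>y\<in>U w (X - {u}). (x, y) \<in> A \<longrightarrow> (h2 x, h2 y) \<in> A'"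
    using B.IH(2)[OF u(4), of w'] B.prems by auto
  define h where "h x = (if x \<in> S w u then h1 x else h2 x)" for x
  have hin: "h x = h1 x" if "x \<in> S w u" for x using that by (simp add: h_def)
  have hout: "h x = h2 x" if "x \<in> U w (X - {u})" for x
    using that U_disj[OF B.prems(2) u(1)] by (auto simp: h_def)
  have "(h x, h y) \<in> A'" if "x \<in> U w X" "y \<in> U w X" "(x, y) \<in> A" for x y
  proof -
    have xy: "x \<in> U w (X - {u}) \<or> x \<in> S w u" "y \<in> U w (X - {u}) \<or> y \<in> S w u"
      using that U_remove[OF u(1)] by auto
    have a: "adj x y" "adj y x" using that by (auto simp: adjr_def)
    consider "x \<in> S w u" "y \<in> S w u" | "x \<in> U w (X - {u})" "y \<in> U w (X - {u})"
      | "x \<in> S w u" "y \<in> U w (X - {u})" | "x \<in> U w (X - {u})" "y \<in> S w u"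
      using xy by blast
    then show ?thesis
    proof cases
      case 1 then show ?thesis using h1 that hin by auto
    next
      case 2 then show ?thesis using h2 that hout by auto
    next
      case 3
      then have e: "x = u" "y = w" using U_cross[OF B.prems(2) u(1)] a by auto
      then have "\<not> d" using that u(2) asym by (auto simp: dr_def split: if_splits)
      then show ?thesis using 3 u' h1 h2 hin hout e by (auto simp: dr_def)
    next
      case 4
      then have e: "y = u" "x = w" using U_cross[OF B.prems(2) u(1)] a by auto
      then have "d" using that u(2) asym by (auto simp: dr_def split: if_splits)
      then show ?thesis using 4 u' h1 h2 hin hout e by (auto simp: dr_def)
    qed
  qed
  moreover have "h w = w'" using hout[of w] h2(1) by simp
  moreover have "\<forall>x\<in>U w X. h x \<in> V'" using h1(2) h2(2) hin hout U_remove[OF u(1)] by auto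
  ultimately show ?case by blast
qed

text \<open>A level function is a homomorphism to the directed path on the integers.\<close>

lemma level_ex: "\<exists>l :: 'a \<Rightarrow> int. \<forall>x y. (x, y) \<in> A \<longrightarrow> l y = l x + 1"
proof -
  obtain c where c: "c \<in> V" using ne by blast
  then obtain f where f: "brs c (nb c) f" using brs_ex by blast
  have "lo {(x, y :: int). y = x + 1} k g" for k g
  proof (induction g arbitrary: k)
    case E then show ?case by simp
  next
    case (B d s f)
    have "dr {(x, y :: int). y = x + 1} d k (if d then k + 1 else k - 1)" by (simp add: dr_def)
    then show ?case using B by auto
  qed
  then obtain l :: "'a \<Rightarrow> int" where
    "\<forall>x\<in>V. \<forall>y\<in>V. (x, y) \<in> A \<longrightarrow> (l x, l y) \<in> {(x, y). y = x + 1}"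
    using hom_lo[OF f subset_refl, of "{(x, y :: int). y = x + 1}" 0 UNIV] V_decomp[OF c] by auto
  then show ?thesis using AV by (intro exI[of _ l]) auto
qed

end

section \<open>Foldings and the enumeration of branches\<close>

lemma lo_picks: "lo A w R \<Longrightarrow> ((d, u), g) \<in> set (picks R) \<Longrightarrow>
    (\<exists>x. dr A d w x \<and> lo A x u) \<and> lo A w g"
proof (induction R arbitrary: g)
  case (B e s R)
  from B.prems(2) consider "d = e" "u = s" "g = R" | g' where "((d, u), g') \<in> set (picks R)" "g = B e s g'"
    by auto
  then show ?case
  proof cases
    case 1
    then show ?thesis using B.prems(1) by simp
  next
    case 2
    then show ?thesis using B.IH(2)[of g'] B.prems(1) by simp
  qed
qed simp

lemma rhom_lo: "rhom f R \<Longrightarrow> lo A w R \<Longrightarrow> lo A w f"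
proof (induction f R arbitrary: w rule: rhom.induct)
  case (1 R)
  then show ?case by simp
next
  case (2 d s f R)
  then obtain u g where p: "((d, u), g) \<in> set (picks R)" "rhom s (B (\<not> d) g u)"
    by (auto simp: list_ex_iff)
  then obtain x where x: "dr A d w x" "lo A x u" "lo A w g" using lo_picks 2 by metis
  then have "lo A x (B (\<not> d) g u)" by auto
  then have "lo A x s" using 2(1)[OF p(1) refl refl] p(2) by blast
  then show ?case using x 2 by auto
qed

text \<open>The set \<open>Y\<close> keeps the candidate images apart from the top vertex that is to
  be folded; deeper vertices remain unrestricted as in \<open>lo\<close>.\<close>

fun lov :: "('v \<times> 'v) set \<Rightarrow> 'v set \<Rightarrow> 'v \<Rightarrow> fo \<Rightarrow> bool" where
  "lov A Y w E \<longleftrightarrow> True"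
| "lov A Y w (B d s f) \<longleftrightarrow> (\<exists>u\<in>Y. dr A d w u \<and> lo A u s) \<and> lov A Y w f"

lemma lov_lo: "lov A Y w f \<Longrightarrow> lo A w f"
  by (induction f) auto

lemma lov_mono: "lov A Y w f \<Longrightarrow> Y \<subseteq> Z \<Longrightarrow> lov A Z w f"
  by (induction f) auto

lemma lov_app: "lov A Y w (app f g) \<longleftrightarrow> lov A Y w f \<and> lov A Y w g"
  by (induction f) auto

lemma lov_picks: "lov A Y w R \<Longrightarrow> ((d, u), g) \<in> set (picks R) \<Longrightarrow>
    (\<exists>x\<in>Y. dr A d w x \<and> lo A x u) \<and> lo A w g"
proof (induction R arbitrary: g)
  case (B e s R)
  from B.prems(2) consider "d = e" "u = s" "g = R" | g' where "((d, u), g') \<in> set (picks R)" "g = B e s g'"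
    by auto
  then show ?case
  proof cases
    case 1
    then show ?thesis using B.prems(1) lov_lo by auto
  next
    case 2
    then show ?thesis using B.IH(2)[of g'] B.prems(1) by auto
  qed
qed simp

locale core_otree = otree +
  assumes core: "\<lbrakk>\<And>x. x \<in> V \<Longrightarrow> h x \<in> V; \<And>x y. (x, y) \<in> A \<Longrightarrow> (h x, h y) \<in> A\<rbrakk> \<Longrightarrow> inj_on h V"
begin

text \<open>The identity outside the branch at \<open>u\<close> would extend the homomorphism on this branch to a
  non-injective endomorphism.\<close>

lemma no_fold:
  assumes "dr A d w u" "dr A d w x" "u \<noteq> x" "brs u (nb u - {w}) s" "lo A x s"
  shows False
proof -
  have uw: "adj w u" "u \<in> V" "adj w x" "x \<in> V" using assms dr_adj dr_V by blast+
  have Su: "S w u = U u (nb u - {w})" using S_decomp uw by blast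
  obtain h where h: "h u = x" "\<forall>y\<in>S w u. h y \<in> V"
    "\<forall>y\<in>S w u. \<forall>z\<in>S w u. (y, z) \<in> A \<longrightarrow> (h y, h z) \<in> A"
    using hom_lo[OF assms(4) _ assms(5) uw(4) AV] Su by auto
  define k where "k y = (if y \<in> S w u then h y else y)" for y
  have xn: "x \<notin> S w u" using S_uniq[OF uw(1,3), of x] assms(3) by auto
  have wn: "w \<notin> S w u" using S_notin[of u w] adj_neq[OF uw(1)] by auto
  have cross: "y = u \<and> z = w" if "adj y z" "y \<in> S w u" "z \<notin> S w u" for y z
  proof -
    have "y \<noteq> w" using that wn by auto
    then have "z = w" using S_step[of y w u z] that by auto
    then have "y = u" using S_uniq[of w y u y] that uw adj_sym by auto
    then show ?thesis using \<open>z = w\<close> by simp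
  qed
  have "(k y, k z) \<in> A" if yz: "(y, z) \<in> A" for y z
  proof -
    have a: "adj y z" "adj z y" using yz by (auto simp: adjr_def)
    consider "y \<in> S w u" "z \<in> S w u" | "y \<notin> S w u" "z \<notin> S w u"
      | "y \<in> S w u" "z \<notin> S w u" | "y \<notin> S w u" "z \<in> S w u" by blast
    then show ?thesis
    proof cases
      case 3
      then have e: "y = u" "z = w" using cross a by auto
      then have "\<not> d" using yz assms(1) asym by (auto simp: dr_def split: if_splits)
      then show ?thesis using e assms(2) wn h(1) by (auto simp: k_def dr_def)
    next
      case 4
      then have e: "z = u" "y = w" using cross a by auto
      then have d using yz assms(1) asym by (auto simp: dr_def split: if_splits)
      then show ?thesis using e assms(2) wn h(1) by (auto simp: k_def dr_def)
    qed (use yz h in \<open>auto simp: k_def\<close>)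
  qed
  moreover have "\<And>y. y \<in> V \<Longrightarrow> k y \<in> V" using h by (auto simp: k_def)
  ultimately have "inj_on k V" using core by blast
  moreover have "k u = k x" using xn h(1) by (auto simp: k_def)
  ultimately show False using uw assms(3) by (auto dest: inj_onD)
qed

text \<open>Each success of \<open>rhom\<close> would be a folding in the sense of
  \<open>no_fold\<close>, with a target different from the folded top vertex because
  \<open>X\<close> and \<open>Y\<close> are disjoint. The forest \<open>acc\<close> has to be
  present only up to homomorphism, so that it may stand for partial knowledge about the
  surroundings, as in \<open>arm1\<close>.\<close>

lemma foldfree_sound:
  assumes "brs w X f" "X \<subseteq> nb w" "lov A Y w acc" "X \<inter> Y = {}"
  shows "foldfree f acc"
  using assms
proof (induction f arbitrary: w X Y acc)
  case E
  then show ?case by simp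
next
  case (B d s f)
  from B.prems(1) obtain u where u: "u \<in> X" "dr A d w u" "brs u (nb u - {w}) s" "brs w (X - {u}) f"
    by auto
  have rest: "lov A (X - {u} \<union> Y) w (app f acc)"
  proof -
    have "lov A X' w f" if "brs w X' f" for X'
      using that
    proof (induction f arbitrary: X')
      case (B d s f)
      then obtain u where "u \<in> X'" "dr A d w u" "brs u (nb u - {w}) s" "brs w (X' - {u}) f" by auto
      then show ?case using B(2) lov_mono[of A "X' - {u}" w f X'] brs_lo by auto
    qed simp
    then show ?thesis using u(4) B.prems(3) by (auto simp: lov_app intro: lov_mono)
  qed
  have 1: "\<not> rhom s (B (\<not> d) (B d s g) v)" if p: "((d, v), g) \<in> set (picks (app f acc))" for v g
  proof
    assume r: "rhom s (B (\<not> d) (B d s g) v)"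
    obtain x where x: "x \<in> X - {u} \<union> Y" "dr A d w x" "lo A x v" "lo A w g"
      using lov_picks[OF rest p] by blast
    have "lo A w (B d s g)" using x(4) u(2) brs_lo[OF u(3)] by auto
    then have "lo A x (B (\<not> d) (B d s g) v)" using x(2,3) by auto
    then have "lo A x s" by (rule rhom_lo[OF r])
    moreover have "u \<noteq> x" using x(1) u(1) B.prems(4) by auto
    ultimately show False using no_fold[OF u(2) x(2) _ u(3)] by blast
  qed
  have 2: "foldfree s (B (\<not> d) (app f acc) E)"
    by (rule B.IH(1)[OF u(3), of "{w}"]) (use u(2) lov_lo[OF rest] in auto)
  have 3: "foldfree f (B d s acc)"
    by (rule B.IH(2)[OF u(4), of "insert u Y"])
      (use u(1,2) brs_lo[OF u(3)] B.prems lov_mono[of A Y w acc "insert u Y"] in auto)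
  show ?case using 1 2 3 by (auto simp: list_all_iff)
qed

text \<open>Induction along \<open>bs\<close>: if \<open>b\<close> codes a branch with top vertex in
  \<open>X\<close>, this branch is split off, and by \<open>no_fold\<close> no other top vertex in
  \<open>X\<close> has the code \<open>b\<close>; otherwise \<open>b\<close> is skipped.\<close>

lemma subs_complete:
  assumes "w \<in> V" "X \<subseteq> nb w" "card (U w X) = Suc m"
    and "\<And>u. u \<in> X \<Longrightarrow> \<exists>d s. (d, s) \<in> set bs \<and> dr A d w u \<and> brs u (nb u - {w}) s"
  shows "\<exists>f\<in>set (subs m bs). brs w X f"
  using assms(2-4)
proof (induction bs arbitrary: X m)
  case Nil
  then have "X = {}" by auto
  then show ?case using Nil by auto
next
  case (Cons b bs)
  obtain d s where b: "b = (d, s)" by (cases b)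
  show ?case
  proof (cases m)
    case 0
    have "X = {}"
    proof (rule ccontr)
      assume "X \<noteq> {}"
      then obtain u where u: "u \<in> X" by blast
      then have "u \<in> V" using Cons(2) nb_V by blast
      then have "0 < card (S w u)" using S_card_pos by blast
      moreover have "0 < card (U w (X - {u}))" using finite_U[OF assms(1), of "X - {u}"] Cons(2)
        by (metis Diff_subset U_self card_gt_0_iff empty_iff subset_trans)
      ultimately show False using card_U_remove[OF assms(1) Cons(2) u] Cons(3) 0 by simp
    qed
    then show ?thesis using 0 by auto
  next
    case (Suc m')
    show ?thesis
    proof (cases "\<exists>u\<in>X. dr A d w u \<and> brs u (nb u - {w}) s")
      case True
      then obtain u where u: "u \<in> X" "dr A d w u" "brs u (nb u - {w}) s" by blast
      have uw: "adj w u" "u \<in> V" using u dr_adj dr_V by blast+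
      have cS: "card (S w u) = Suc (sz s)" using brs_card[OF u(3) uw(2)] S_decomp[OF uw(1)] by auto
      have pos: "0 < card (U w (X - {u}))" using finite_U[OF assms(1), of "X - {u}"] Cons(2)
        by (metis Diff_subset U_self card_gt_0_iff empty_iff subset_trans)
      have c: "sz s \<le> m'" "card (U w (X - {u})) = Suc (m' - sz s)"
        using card_U_remove[OF assms(1) Cons(2) u(1)] cS Cons(3) Suc pos by auto
      have "\<exists>f\<in>set (subs (m' - sz s) bs). brs w (X - {u}) f"
      proof (rule Cons.IH)
        fix v assume v: "v \<in> X - {u}"
        then obtain e t where t: "(e, t) \<in> set (b # bs)" "dr A e w v" "brs v (nb v - {w}) t"
          using Cons(4) by blast
        have "(e, t) \<noteq> b"
        proof
          assume "(e, t) = b"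
          then have "dr A d w v" "lo A v s" using t b brs_lo by auto
          then show False using no_fold[OF u(2) _ _ u(3)] v by auto
        qed
        then show "\<exists>d s. (d, s) \<in> set bs \<and> dr A d w v \<and> brs v (nb v - {w}) s" using t by auto
      qed (use Cons(2) c in auto)
      then obtain f where f: "f \<in> set (subs (m' - sz s) bs)" "brs w (X - {u}) f" by blast
      then have "brs w X (B d s f)" using u by auto
      moreover have "B d s f \<in> set (subs m (b # bs))" using f(1) c(1) b Suc by (auto simp: Let_def)
      ultimately show ?thesis by blast
    next
      case False
      have "\<exists>f\<in>set (subs m bs). brs w X f"
        by (rule Cons.IH) (use Cons(2-4) False b in auto, use Cons(4) False b in fastforce)
      then show ?thesis using Suc by (auto simp: Let_def)
    qed
  qed
qed

text \<open>The code \<open>s\<close> of the child forest does not depend on the arc from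
  \<open>v\<close>, so it occurs with both flags. Only foldings strictly inside the branch are
  tested, with \<open>E\<close> as \<open>acc\<close>, since nothing is known beyond
  \<open>v\<close>.\<close>

lemma branches_complete:
  assumes "adj v w" "card (S v w) \<le> m"
  shows "\<exists>s. (\<forall>d. (d, s) \<in> set (branches m)) \<and> brs w (nb w - {v}) s"
  using assms
proof (induction m arbitrary: v w)
  case 0
  then show ?case using S_card_pos[of w v] adj_V by fastforce
next
  case (Suc m)
  show ?case
  proof (cases "card (S v w) \<le> m")
    case True
    then show ?thesis using Suc.IH[OF Suc.prems(1)] by (auto simp: Let_def)
  next
    case False
    have wV: "w \<in> V" using Suc adj_V by blast
    have c: "card (U w (nb w - {v})) = Suc m" using S_decomp[OF Suc.prems(1)] Suc.prems(2) False by simp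
    have "\<exists>f\<in>set (subs m (branches m)). brs w (nb w - {v}) f"
    proof (rule subs_complete[OF wV _ c])
      fix u assume u: "u \<in> nb w - {v}"
      then have uw: "adj w u" by (auto simp: nb_def)
      have "card (S w u) < card (U w (nb w - {v}))"
        using card_U_remove[OF wV _ u] S_card_pos
          finite_U[OF wV, of "nb w - {v} - {u}"]
        by (metis Diff_subset U_self card_gt_0_iff empty_iff less_add_same_cancel2 subset_trans)
      then have "card (S w u) \<le> m" using c by simp
      then show "\<exists>d s. (d, s) \<in> set (branches m) \<and> dr A d w u \<and> brs u (nb u - {w}) s"
        using Suc.IH[OF uw] adj_dr[OF uw] by blast
    qed auto
    then obtain f where f: "f \<in> set (subs m (branches m))" "brs w (nb w - {v}) f" by blast
    have "foldfree f E" by (rule foldfree_sound[OF f(2), of "{}"]) auto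
    then have "\<forall>d. (d, f) \<in> set (branches (Suc m))" using f(1)
      by (auto simp: Let_def simp del: foldfree.simps)
    then show ?thesis using f(2) by blast
  qed
qed

end

section \<open>Majority from medians\<close>

context otree
begin

section \<open>Levels and medians\<close>

definition lev :: "'a \<Rightarrow> int" where
  "lev = (SOME l. \<forall>x y. (x, y) \<in> A \<longrightarrow> l y = l x + 1)"

lemma lev_arc: "(x, y) \<in> A \<Longrightarrow> lev y = lev x + 1"
  using someI_ex[OF level_ex] unfolding lev_def by blast

lemma lev_dr: "dr A d x y \<Longrightarrow> lev y = lev x + (if d then 1 else - 1)"
  using lev_arc by (fastforce simp: dr_def split: if_splits)

lemma dr_lev: "adj x y \<Longrightarrow> lev y = lev x + (if d then 1 else - 1) \<Longrightarrow> dr A d x y"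
  using lev_arc[of x y] lev_arc[of y x] by (auto simp: dr_def adjr_def)

text \<open>With \<open>tow m m = m\<close>, two vertices may share a direction at \<open>m\<close>
  only if both are equal to \<open>m\<close>. In particular, a vertex that occurs twice is the
  median.\<close>

definition med :: "'a \<Rightarrow> 'a \<Rightarrow> 'a \<Rightarrow> 'a \<Rightarrow> bool" where
  "med m x y z \<longleftrightarrow> m \<in> V \<and> (tow m x = tow m y \<longrightarrow> x = m) \<and> (tow m x = tow m z \<longrightarrow> x = m) \<and>
     (tow m y = tow m z \<longrightarrow> y = m)"

lemma tow_eq_self: "x \<in> V \<Longrightarrow> m \<in> V \<Longrightarrow> tow m x = m \<longleftrightarrow> x = m"
  using tow_neq tow_self by metis

lemma med_swap12: "x \<in> V \<Longrightarrow> y \<in> V \<Longrightarrow> z \<in> V \<Longrightarrow> med m x y z \<Longrightarrow> med m y x z"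
  unfolding med_def using tow_eq_self by metis

lemma med_swap23: "x \<in> V \<Longrightarrow> y \<in> V \<Longrightarrow> z \<in> V \<Longrightarrow> med m x y z \<Longrightarrow> med m x z y"
  unfolding med_def using tow_eq_self by metis

lemma tow_in_branch: assumes "adj m w" "y \<in> S m w" shows "tow w y \<noteq> m"
proof (cases "y = w")
  case True then show ?thesis using adj_neq assms by auto
next
  case False
  then obtain u where "u \<in> nb w - {m}" "y \<in> S w u"
    using assms S_decomp by (auto simp: U_def)
  then show ?thesis using tow_eqI[of w u y] by (auto simp: nb_def)
qed

text \<open>Start at \<open>x\<close> and step towards \<open>y\<close> as long as \<open>z\<close>
  lies in the same direction. The vertex \<open>x\<close> stays behind, and the branch containing
  \<open>y\<close> shrinks with each step.\<close>

lemma med_ex: assumes "x \<in> V" "y \<in> V" "z \<in> V" shows "\<exists>m. med m x y z"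
proof -
  have "\<exists>m. med m x y z"
    if "m \<in> V" "m = x \<or> tow m x \<noteq> tow m y \<and> tow m x \<noteq> tow m z" for m
    using that
  proof (induction "card (S m (tow m y))" arbitrary: m rule: less_induct)
    case less
    show ?case
    proof (cases "tow m y = tow m z \<and> y \<noteq> m")
      case False
      then have "med m x y z" using less.prems unfolding med_def by auto
      then show ?thesis by blast
    next
      case True
      define w where "w = tow m y"
      have w: "adj m w" "y \<in> S m w" "z \<in> S m w" "w \<in> V"
      proof -
        show "adj m w" "y \<in> S m w" using tow_props[of y m] True assms less.prems by (auto simp: w_def)
        then have "z \<noteq> m" using True adj_neq unfolding w_def by fastforce
        then show "z \<in> S m w" using tow_props(2)[of z m] True assms less.prems by (auto simp: w_def)
        show "w \<in> V" using adj_V[OF \<open>adj m w\<close>] by simp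
      qed
      have xw: "tow w x = m"
      proof (cases "x = m")
        case True then show ?thesis using tow_adj w adj_sym by blast
      next
        case False
        then have "tow m x \<noteq> tow m w" using less.prems tow_adj[OF w(1)] by (auto simp: w_def)
        then have "tow w x = tow w m"
          using tow_other[of m w x] less.prems w assms adj_neq[OF w(1)] by auto
        then show ?thesis using tow_adj w adj_sym by metis
      qed
      have P: "tow w x \<noteq> tow w y" "tow w x \<noteq> tow w z" using xw tow_in_branch[OF w(1,2)] tow_in_branch[OF w(1,3)] by auto
      show ?thesis
      proof (cases "y = w")
        case True
        then have "med w x y z" using P w unfolding med_def by auto
        then show ?thesis by blast
      next
        case False
        have u: "adj w (tow w y)" using tow_props[of y w] False assms w by auto
        have un: "tow w y \<in> nb w - {m}" using u P xw by (auto simp: nb_def)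
        have "card (S w (tow w y)) < card (U w (nb w - {m}))"
          using card_U_remove[OF w(4) _ un] finite_U[OF w(4), of "nb w - {m} - {tow w y}"]
          by (metis Diff_subset U_self card_gt_0_iff empty_iff less_add_same_cancel2 subset_trans)
        then have "card (S w (tow w y)) < card (S m (tow m y))"
          using S_decomp[OF w(1)] by (simp add: w_def)
        then show ?thesis using less.hyps w P by blast
      qed
    qed
  qed
  then show ?thesis using assms by blast
qed

text \<open>At most one of \<open>x, y, z\<close> lies in the branch at \<open>m\<close> that
  contains \<open>m'\<close>. The other two are seen from \<open>m'\<close> in the direction of
  \<open>m\<close>, so \<open>m'\<close> cannot be a median.\<close>

lemma med_unique:
  assumes "x \<in> V" "y \<in> V" "z \<in> V" "med m x y z" "med m' x y z" shows "m = m'"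
proof (rule ccontr)
  assume ne: "m \<noteq> m'"
  have mV: "m \<in> V" "m' \<in> V" using assms by (auto simp: med_def)
  have far: "tow m' p = tow m' m" if "p \<in> V" "tow m p \<noteq> tow m m'" for p
    using tow_other[of m m' p] that mV ne by auto
  have b: "tow m m' \<noteq> m" using tow_neq mV ne by metis
  have "\<not> (tow m x = tow m m' \<and> tow m y = tow m m')" "\<not> (tow m x = tow m m' \<and> tow m z = tow m m')"
    "\<not> (tow m y = tow m m' \<and> tow m z = tow m m')"
    using assms(4) b unfolding med_def by (metis tow_self)+
  then consider "tow m' x = tow m' m" "tow m' y = tow m' m" | "tow m' x = tow m' m" "tow m' z = tow m' m"
    | "tow m' y = tow m' m" "tow m' z = tow m' m" using far assms by metis
  moreover have "tow m' m \<noteq> m'" using tow_neq mV ne by metis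
  ultimately show False using assms(5) unfolding med_def by (metis tow_self)
qed

text \<open>What the polymorphism has to do on triples whose median \<open>c\<close> is none of the three vertices: the triple
  leaves the arms exactly when a coordinate steps to \<open>c\<close>, and then the new median is \<open>c\<close>.\<close>

definition phi_ok :: "'a \<Rightarrow> 'a \<Rightarrow> 'a \<Rightarrow> 'a \<Rightarrow> ('a \<Rightarrow> 'a \<Rightarrow> 'a \<Rightarrow> 'a) \<Rightarrow> bool" where
  "phi_ok c a1 a2 a3 \<phi> \<longleftrightarrow> (\<forall>x\<in>S c a1. \<forall>y\<in>S c a2. \<forall>z\<in>S c a3. lev x = lev y \<and> lev x = lev z \<longrightarrow>
     \<phi> x y z \<in> V \<and>
     (\<forall>d x' y' z'. dr A d x x' \<and> dr A d y y' \<and> dr A d z z' \<longrightarrow>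
        (if x' = c \<or> y' = c \<or> z' = c then dr A d (\<phi> x y z) c
         else dr A d (\<phi> x y z) (\<phi> x' y' z'))))"

lemma phi_ok_swap12: "phi_ok c a1 a2 a3 \<phi> \<Longrightarrow> phi_ok c a2 a1 a3 (\<lambda>x y z. \<phi> y x z)"
  unfolding phi_ok_def by (smt (verit, best))

lemma phi_ok_swap23: "phi_ok c a1 a2 a3 \<phi> \<Longrightarrow> phi_ok c a1 a3 a2 (\<lambda>x y z. \<phi> x z y)"
  unfolding phi_ok_def by (smt (verit, best))

definition majority3 :: "('a \<Rightarrow> 'a \<Rightarrow> 'a \<Rightarrow> 'a) \<Rightarrow> bool" where
  "majority3 F \<longleftrightarrow> (\<forall>x\<in>V. \<forall>y\<in>V. \<forall>z\<in>V. F x y z \<in> V) \<and>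
     (\<forall>x y z x' y' z'. (x, x') \<in> A \<and> (y, y') \<in> A \<and> (z, z') \<in> A \<longrightarrow> (F x y z, F x' y' z') \<in> A) \<and>
     (\<forall>x\<in>V. \<forall>y\<in>V. F x x y = x \<and> F x y x = x \<and> F y x x = x)"

theorem majority_if_phi:
  assumes phi: "\<And>c a1 a2 a3. \<lbrakk>c \<in> V; a1 \<in> nb c; a2 \<in> nb c; a3 \<in> nb c; a1 \<noteq> a2; a1 \<noteq> a3; a2 \<noteq> a3\<rbrakk> \<Longrightarrow>
      \<exists>\<phi>. phi_ok c a1 a2 a3 \<phi>"
  shows "\<exists>F. majority3 F"
proof -
  define M where "M x y z = (THE m. med m x y z)" for x y z
  have Med: "med (M x y z) x y z" if "x \<in> V" "y \<in> V" "z \<in> V" for x y z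
    using med_ex[OF that] med_unique[OF that] unfolding M_def by (metis theI)
  have M_eq: "M x y z = m" if "x \<in> V" "y \<in> V" "z \<in> V" "med m x y z" for x y z m
    using Med med_unique that by blast
  define P where "P c a1 a2 a3 = (SOME \<phi>. phi_ok c a1 a2 a3 \<phi>)" for c a1 a2 a3
  define G where "G x y z = (let m = M x y z in
      if m \<in> {x, y, z} then m else P m (tow m x) (tow m y) (tow m z) x y z)" for x y z
  \<comment> \<open>An arc in every coordinate raises all levels by 1, so the pattern of equal
    levels is preserved and with it the chosen coordinate. Of two coordinates on a common level the
    first is taken, which respects majority because equal vertices have equal levels.\<close>
  define F where "F x y z = (if lev x = lev y \<and> lev x = lev z then G x y z
      else if lev x = lev y \<or> lev x = lev z then x else if lev y = lev z then y else x)" for x y z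
  have Gin: "G x y z = m" if "x \<in> V" "y \<in> V" "z \<in> V" "med m x y z" "m \<in> {x, y, z}" for x y z m
    using M_eq[OF that(1-4)] that(5) by (simp add: G_def)
  have Gout: "G x y z = P m (tow m x) (tow m y) (tow m z) x y z"
    if "x \<in> V" "y \<in> V" "z \<in> V" "med m x y z" "m \<notin> {x, y, z}" for x y z m
    using M_eq[OF that(1-4)] that(5) unfolding G_def Let_def by auto
  have POK: "phi_ok m (tow m x) (tow m y) (tow m z) (P m (tow m x) (tow m y) (tow m z))
      \<and> x \<in> S m (tow m x) \<and> y \<in> S m (tow m y) \<and> z \<in> S m (tow m z)"
    if "x \<in> V" "y \<in> V" "z \<in> V" "med m x y z" "m \<notin> {x, y, z}" for x y z m
  proof -
    have mV: "m \<in> V" using that by (auto simp: med_def)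
    have "tow m x \<noteq> tow m y" "tow m x \<noteq> tow m z" "tow m y \<noteq> tow m z"
      using that by (auto simp: med_def)
    moreover have "tow m x \<in> nb m" "tow m y \<in> nb m" "tow m z \<in> nb m"
      using tow_props(1) mV that unfolding nb_def by auto
    ultimately have "\<exists>\<phi>. phi_ok m (tow m x) (tow m y) (tow m z) \<phi>" using phi mV by blast
    then have "phi_ok m (tow m x) (tow m y) (tow m z) (P m (tow m x) (tow m y) (tow m z))"
      unfolding P_def by (rule someI_ex)
    then show ?thesis using tow_props(2) mV that by auto
  qed
  have G_V: "G x y z \<in> V" if "x \<in> V" "y \<in> V" "z \<in> V" "lev x = lev y" "lev x = lev z" for x y z
  proof (cases "M x y z \<in> {x, y, z}")
    case True then show ?thesis using that by (auto simp: G_def)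
  next
    case False
    note f = that(1-3) Med[OF that(1-3)] False
    show ?thesis unfolding Gout[OF f] using POK[OF f] that(4,5) unfolding phi_ok_def by blast
  qed
  have A_case: "dr A d (G x y z) (G x' y' z')"
    if lv: "lev x = lev y" "lev x = lev z" and d: "dr A d x x'" "dr A d y y'" "dr A d z z'"
      and out: "M x y z \<notin> {x, y, z}" for d x y z x' y' z'
  proof -
    have xV: "x \<in> V" "y \<in> V" "z \<in> V" and xV': "x' \<in> V" "y' \<in> V" "z' \<in> V" using dr_V d by blast+
    define m where "m = M x y z"
    have m: "med m x y z" "m \<notin> {x, y, z}" "m \<in> V" using Med[OF xV] out by (auto simp: m_def med_def)
    note ok = POK[OF xV m(1,2)]
    have ts: "tow m x' = (if x' = m then m else tow m x)" "tow m y' = (if y' = m then m else tow m y)"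
      "tow m z' = (if z' = m then m else tow m z)"
      using tow_step[of x x' m] tow_step[of y y' m] tow_step[of z z' m] d dr_adj m by auto
    have tn: "tow m x \<noteq> m" "tow m y \<noteq> m" "tow m z \<noteq> m" using tow_neq xV m by auto
    have m': "med m x' y' z'" using m ts tn unfolding med_def by auto
    have st: "if x' = m \<or> y' = m \<or> z' = m then dr A d (P m (tow m x) (tow m y) (tow m z) x y z) m
         else dr A d (P m (tow m x) (tow m y) (tow m z) x y z) (P m (tow m x) (tow m y) (tow m z) x' y' z')"
      using ok lv d unfolding phi_ok_def by blast
    show ?thesis
    proof (cases "m \<in> {x', y', z'}")
      case True
      then show ?thesis using Gin[OF xV' m' True] Gout[OF xV m(1,2)] st by auto
    next
      case False
      then show ?thesis using Gout[OF xV' m' False] Gout[OF xV m(1,2)] st ts by auto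
    qed
  qed
  \<comment> \<open>When the median passes from coordinate \<open>x\<close> to coordinate
    \<open>y'\<close>, the two are joined by an arc: otherwise \<open>x'\<close> and
    \<open>z'\<close> would both be seen from \<open>y'\<close> in the direction of
    \<open>x\<close>, against the median property of \<open>y'\<close>.\<close>
  have C_case: "dr A d x y'"
    if lv: "lev x = lev y" "lev x = lev z" and d: "dr A d x x'" "dr A d y y'" "dr A d z z'"
      and m: "med x x y z" "med y' x' y' z'" for d x y z x' y' z'
  proof (rule ccontr)
    assume no: "\<not> dr A d x y'"
    have xV: "x \<in> V" "y \<in> V" "z \<in> V" and xV': "x' \<in> V" "y' \<in> V" "z' \<in> V" using dr_V d by blast+
    have lv': "lev x' = lev x + (if d then 1 else -1)" "lev y' = lev x + (if d then 1 else -1)"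
       "lev z' = lev x + (if d then 1 else -1)" using lev_dr d lv by auto
    have nadj: "\<not> adj x y'" using no dr_lev lv' by blast
    have n1: "x' \<noteq> y'" "x \<noteq> y" "y' \<noteq> x" "z' \<noteq> x" using no d lv' by (auto split: if_splits)
    have a: "adj x x'" "adj y y'" "adj z z'" using d dr_adj by blast+
    have 1: "tow y' x' = tow y' x" using tow_step[OF a(1)] n1 xV' by auto
    have 2: "tow y' z' = tow y' x"
    proof (cases "z = x")
      case True
      then have "z' \<noteq> y'" using a(3) nadj by auto
      then have "tow y' z = tow y' z'" using tow_step[OF a(3), of y'] True n1 xV' by auto
      then show ?thesis using True by simp
    next
      case False
      have "tow x z \<noteq> tow x y" using m(1) False n1 unfolding med_def by (metis tow_eq_self xV)
      moreover have "tow x y' = tow x y" using tow_step[OF a(2), of x] n1 xV by auto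
      moreover have "tow x z' = tow x z" using tow_step[OF a(3), of x] n1 xV False by auto
      ultimately show ?thesis using tow_other[of x y' z'] xV xV' n1 by auto
    qed
    show False using m(2) 1 2 n1 unfolding med_def by auto
  qed
  have step: "dr A d (G x y z) (G x' y' z')"
    if lv: "lev x = lev y" "lev x = lev z" and d: "dr A d x x'" "dr A d y y'" "dr A d z z'"
    for d x y z x' y' z'
  proof -
    have xV: "x \<in> V" "y \<in> V" "z \<in> V" and xV': "x' \<in> V" "y' \<in> V" "z' \<in> V" using dr_V d by blast+
    have lv': "lev x' = lev y'" "lev x' = lev z'" using lev_dr d lv by auto
    consider "M x y z \<notin> {x, y, z}" | "M x' y' z' \<notin> {x', y', z'}"
      | "M x y z \<in> {x, y, z}" "M x' y' z' \<in> {x', y', z'}" by blast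
    then show ?thesis
    proof cases
      case 1 then show ?thesis using A_case lv d by blast
    next
      case 2
      then have "dr A (\<not> d) (G x' y' z') (G x y z)" using A_case[OF lv', of "\<not> d"] d by simp
      then show ?thesis by simp
    next
      case 3
      define m m' where "m = M x y z" and "m' = M x' y' z'"
      have m: "med m x y z" "med m' x' y' z'" using Med xV xV' by (auto simp: m_def m'_def)
      have sw: "med m y x z" "med m x z y" "med m y z x" "med m z x y" "med m z y x"
        using m(1) med_swap12 med_swap23 xV by blast+
      have sw': "med m' y' x' z'" "med m' x' z' y'" "med m' y' z' x'" "med m' z' x' y'" "med m' z' y' x'"
        using m(2) med_swap12 med_swap23 xV' by blast+
      have lvs: "lev y = lev x" "lev z = lev x" "lev y = lev z" "lev z = lev y" using lv by auto
      have eq: "G x y z = m" "G x' y' z' = m'" using 3 by (auto simp: G_def m_def m'_def)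
      have "m \<in> {x, y, z}" "m' \<in> {x', y', z'}" using 3 by (auto simp: m_def m'_def)
      then consider "m = x" "m' = x'" | "m = y" "m' = y'" | "m = z" "m' = z'"
        | "m = x" "m' = y'" | "m = x" "m' = z'" | "m = y" "m' = x'" | "m = y" "m' = z'"
        | "m = z" "m' = x'" | "m = z" "m' = y'" by auto
      then have "dr A d m m'"
      proof cases
        case 1 then show ?thesis using d(1) by simp
      next
        case 2 then show ?thesis using d(2) by simp
      next
        case 3 then show ?thesis using d(3) by simp
      next
        case 4 then show ?thesis using C_case[OF lv(1) lv(2) d(1) d(2) d(3)] m(1) m(2) by fast
      next
        case 5 then show ?thesis using C_case[OF lv(2) lv(1) d(1) d(3) d(2)] sw(2) sw'(2) by fast
      next
        case 6 then show ?thesis using C_case[OF lvs(1) lvs(3) d(2) d(1) d(3)] sw(1) sw'(1) by fast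
      next
        case 7 then show ?thesis using C_case[OF lvs(3) lvs(1) d(2) d(3) d(1)] sw(3) sw'(3) by fast
      next
        case 8 then show ?thesis using C_case[OF lvs(2) lvs(4) d(3) d(1) d(2)] sw(4) sw'(4) by fast
      next
        case 9 then show ?thesis using C_case[OF lvs(4) lvs(2) d(3) d(2) d(1)] sw(5) sw'(5) by fast
      qed
      then show ?thesis using eq by simp
    qed
  qed
  have "majority3 F"
    unfolding majority3_def
  proof (intro conjI ballI allI impI)
    fix x y z assume "x \<in> V" "y \<in> V" "z \<in> V"
    then show "F x y z \<in> V" using G_V by (auto simp: F_def)
  next
    fix x y z x' y' z' assume a: "(x, x') \<in> A \<and> (y, y') \<in> A \<and> (z, z') \<in> A"
    then have l: "lev x' = lev x + 1" "lev y' = lev y + 1" "lev z' = lev z + 1" using lev_arc by auto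
    show "(F x y z, F x' y' z') \<in> A"
      using step[of x y z True x' y' z'] a l by (auto simp: F_def dr_def)
  next
    fix x y assume xy: "x \<in> V" "y \<in> V"
    have "med x x x y" "med x x y x" "med x y x x"
      using xy tow_eq_self[of y x] unfolding med_def by (auto simp: eq_commute)
    then have "G x x y = x" "G x y x = x" "G y x x = x" using Gin xy by auto
    then show "F x x y = x" "F x y x = x" "F y x x = x" by (auto simp: F_def)
  qed
  then show ?thesis by blast
qed

end

section \<open>Labelling the parts of an arm\<close>

context otree
begin

definition elv :: "bool \<Rightarrow> 'a \<Rightarrow> 'a \<Rightarrow> int" where
  "elv e c v = (if e then lev v - lev c else lev c - lev v)"

lemma elv_self [simp]: "elv e c c = 0"
  by (simp add: elv_def)

lemma elv_dr: "dr A d x y \<Longrightarrow> elv e c y = elv e c x + (if d = e then 1 else - 1)"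
  using lev_dr by (auto simp: elv_def split: if_splits)

lemma dr_elv: "adj x y \<Longrightarrow> elv e c y = elv e c x + (if d = e then 1 else - 1) \<Longrightarrow> dr A d x y"
  by (rule dr_lev) (auto simp: elv_def split: if_splits)

text \<open>Only a correct labelling is required, i.e. \<open>lsingle\<close> and \<open>lnear\<close> may fail to recognise a part.\<close>

definition goodlab :: "bool \<Rightarrow> 'a \<Rightarrow> 'a \<Rightarrow> ('a \<Rightarrow> lab) \<Rightarrow> 'a set \<Rightarrow> bool" where
  "goodlab e c a lb W \<longleftrightarrow>
     (\<forall>x\<in>W. 1 \<le> elv e c x \<longrightarrow> elv e c x \<le> int (lht (lb x))) \<and>
     (\<forall>x\<in>W. \<forall>y\<in>W. adj x y \<longrightarrow>
        (1 \<le> elv e c x \<and> 1 \<le> elv e c y \<longrightarrow> lb x = lb y) \<and>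
        (elv e c x = 1 \<and> elv e c y = 0 \<longrightarrow>
           (lsingle (lb x) \<longrightarrow> x = a) \<and> (lnear (lb x) \<longrightarrow> adj a y \<and> elv e c a = 1)))"

lemma goodlab_join:
  assumes X: "X \<subseteq> nb w" "u \<in> X"
    and g1: "goodlab e c a lb1 (S w u)" and g2: "goodlab e c a lb2 (U w (X - {u}))"
    and same: "1 \<le> elv e c w \<Longrightarrow> 1 \<le> elv e c u \<Longrightarrow> lb1 u = lb2 w"
    and up: "elv e c u = 1 \<Longrightarrow> elv e c w = 0 \<Longrightarrow>
      (lsingle (lb1 u) \<longrightarrow> u = a) \<and> (lnear (lb1 u) \<longrightarrow> adj a w \<and> elv e c a = 1)"
    and down: "elv e c w = 1 \<Longrightarrow> elv e c u = 0 \<Longrightarrow>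
      (lsingle (lb2 w) \<longrightarrow> w = a) \<and> (lnear (lb2 w) \<longrightarrow> adj a u \<and> elv e c a = 1)"
  shows "\<exists>lb. goodlab e c a lb (U w X) \<and> (\<forall>x\<in>S w u. lb x = lb1 x) \<and> (\<forall>x\<in>U w (X - {u}). lb x = lb2 x)"
proof -
  define l where "l x = (if x \<in> S w u then lb1 x else lb2 x)" for x
  have l1: "l x = lb1 x" if "x \<in> S w u" for x using that by (simp add: l_def)
  have l2: "l x = lb2 x" if "x \<in> U w (X - {u})" for x
    using that U_disj[OF X] by (auto simp: l_def)
  have Ux: "x \<in> S w u \<or> x \<in> U w (X - {u})" if "x \<in> U w X" for x
    using that U_remove[OF X(2)] by blast
  have lw: "l w = lb2 w" "l u = lb1 u" using l1 l2 by auto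
  have "goodlab e c a l (U w X)"
    unfolding goodlab_def
  proof (intro conjI ballI impI)
    fix x assume "x \<in> U w X" "1 \<le> elv e c x"
    then show "elv e c x \<le> int (lht (l x))"
      using Ux[of x] l1 l2 g1 g2 unfolding goodlab_def by metis
  next
    fix x y assume xy: "x \<in> U w X" "y \<in> U w X" "adj x y"
    consider "x \<in> S w u" "y \<in> S w u" | "x \<in> U w (X - {u})" "y \<in> U w (X - {u})"
      | "x = u" "y = w" | "x = w" "y = u"
      using Ux[OF xy(1)] Ux[OF xy(2)] U_cross[OF X] xy(3) adj_sym by metis
    note cs = this
    show "l x = l y" if "1 \<le> elv e c x \<and> 1 \<le> elv e c y"
      using cs
    proof cases
      case 1 then show ?thesis using g1 that xy l1 unfolding goodlab_def by metis
    next
      case 2 then show ?thesis using g2 that xy l2 unfolding goodlab_def by metis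
    qed (use lw same that in auto)
    assume lv: "elv e c x = 1 \<and> elv e c y = 0"
    have "(lsingle (l x) \<longrightarrow> x = a) \<and> (lnear (l x) \<longrightarrow> adj a y \<and> elv e c a = 1)"
      using cs
    proof cases
      case 1 then show ?thesis using g1 lv xy l1 unfolding goodlab_def by metis
    next
      case 2 then show ?thesis using g2 lv xy l2 unfolding goodlab_def by metis
    next
      case 3 then show ?thesis using lw up lv by auto
    next
      case 4 then show ?thesis using lw down lv by auto
    qed
    then show "lsingle (l x) \<Longrightarrow> x = a" "lnear (l x) \<Longrightarrow> adj a y" "lnear (l x) \<Longrightarrow> elv e c a = 1"
      by blast+
  qed
  then show ?thesis using l1 l2 by blast
qed

text \<open>Simultaneous induction for the two label functions. In the first half the label
  \<open>L\<close> of the part of \<open>w\<close> is prescribed from outside, because height and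
  contacts depend on the whole part and not just on the forest \<open>f\<close>.\<close>

lemma labs_parts:
  "(\<forall>w X n L. brs w X f \<longrightarrow> X \<subseteq> nb w \<longrightarrow> elv e c w = int n + 1 \<longrightarrow> hgt e n f \<le> lht L \<longrightarrow>
      (lsingle L \<or> lnear L \<longrightarrow> \<not> contact e n f) \<longrightarrow>
      (\<exists>lb. lb w = L \<and> goodlab e c a lb (U w X) \<and>
        (\<forall>x\<in>U w X. 1 \<le> elv e c x \<longrightarrow> lb x = L \<or> lb x \<in> set (lab_hi e n f)))) \<and>
   (\<forall>w X n nf. brs w X f \<longrightarrow> X \<subseteq> nb w \<longrightarrow> elv e c w = - int n \<longrightarrow>
      (nf \<longrightarrow> n = 0 \<and> adj a w \<and> elv e c a = 1) \<longrightarrow>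
      (\<exists>lb. goodlab e c a lb (U w X) \<and>
        (\<forall>x\<in>U w X. 1 \<le> elv e c x \<longrightarrow> lb x \<in> set (lab_lo e n nf f))))"
proof (induction f)
  case E
  have "goodlab e c a (\<lambda>_. L) {w}" if "elv e c w \<le> int (lht L)" for L w
    using that adj_neq by (auto simp: goodlab_def)
  then have single: "\<exists>lb. lb w = L \<and> goodlab e c a lb {w} \<and> (\<forall>x\<in>{w}. lb x = L)"
    if "elv e c w \<le> int (lht L)" for L w using that by (intro exI[of _ "\<lambda>_. L"]) auto
  show ?case
  proof (intro conjI allI impI, goal_cases)
    case (1 w X n L)
    then show ?case using single[of w L] by auto
  next
    case (2 w X n nf)
    then show ?case using single[of w "Lab True True True 0"] by auto
  qed
next
  case (B d s f)
  note hi_s = B.IH(1)[THEN conjunct1, rule_format]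
  note lo_s = B.IH(1)[THEN conjunct2, rule_format]
  note hi_f = B.IH(2)[THEN conjunct1, rule_format]
  note lo_f = B.IH(2)[THEN conjunct2, rule_format]
  show ?case
  proof (intro conjI allI impI, goal_cases)
    case (1 w X n L)
    from 1(1) obtain u where u: "u \<in> X" "dr A d w u" "brs u (nb u - {w}) s" "brs w (X - {u}) f" by auto
    have Su: "S w u = U u (nb u - {w})" using S_decomp dr_adj u(2) by blast
    have eu: "elv e c u = elv e c w + (if d = e then 1 else - 1)" using elv_dr u(2) by blast
    obtain l2 where l2: "l2 w = L" "goodlab e c a l2 (U w (X - {u}))"
      "\<forall>x\<in>U w (X - {u}). 1 \<le> elv e c x \<longrightarrow> l2 x = L \<or> l2 x \<in> set (lab_hi e n f)"
      using hi_f[OF u(4), of n L] 1 by auto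
    let ?ls = "if d = e then lab_hi e (Suc n) s
      else case n of 0 \<Rightarrow> lab_lo e 0 False s | Suc m \<Rightarrow> lab_hi e m s"
    have "\<exists>l1. (1 \<le> elv e c u \<longrightarrow> l1 u = L) \<and> goodlab e c a l1 (S w u) \<and>
        (\<forall>x\<in>S w u. 1 \<le> elv e c x \<longrightarrow> l1 x = L \<or> l1 x \<in> set ?ls)"
    proof (cases "d = e")
      case True
      then show ?thesis using hi_s[OF u(3), of "Suc n" L] 1 eu by (auto simp: Su)
    next
      case False
      show ?thesis
      proof (cases n)
        case 0
        then show ?thesis using lo_s[OF u(3), of 0 False] 1 eu False by (auto simp: Su)
      next
        case (Suc m)
        then show ?thesis using hi_s[OF u(3), of m L] 1 eu False by (auto simp: Su)
      qed
    qed
    then obtain l1 where l1: "1 \<le> elv e c u \<longrightarrow> l1 u = L" "goodlab e c a l1 (S w u)"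
      "\<forall>x\<in>S w u. 1 \<le> elv e c x \<longrightarrow> l1 x = L \<or> l1 x \<in> set ?ls" by blast
    have dn: "\<not> lsingle L \<and> \<not> lnear L" if "elv e c w = 1" "elv e c u = 0"
      using 1(5) that 1(3) eu by (auto split: if_splits)
    have wpos: "1 \<le> elv e c w" using 1(3) by simp
    obtain l where l: "goodlab e c a l (U w X)" "\<forall>x\<in>S w u. l x = l1 x" "\<forall>x\<in>U w (X - {u}). l x = l2 x"
      using goodlab_join[OF 1(2) u(1) l1(2) l2(2)] l1(1) l2(1) dn wpos by auto
    have "l w = L" using l(3) l2(1) by simp
    moreover have "\<forall>x\<in>U w X. 1 \<le> elv e c x \<longrightarrow> l x = L \<or> l x \<in> set (lab_hi e n (B d s f))"
      using l(2,3) l1(3) l2(3) U_remove[OF u(1)] by auto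
    ultimately show ?case using l(1) by blast
  next
    case (2 w X n nf)
    from 2(1) obtain u where u: "u \<in> X" "dr A d w u" "brs u (nb u - {w}) s" "brs w (X - {u}) f" by auto
    have Su: "S w u = U u (nb u - {w})" using S_decomp dr_adj u(2) by blast
    have eu: "elv e c u = elv e c w + (if d = e then 1 else - 1)" using elv_dr u(2) by blast
    obtain l2 where l2: "goodlab e c a l2 (U w (X - {u}))"
      "\<forall>x\<in>U w (X - {u}). 1 \<le> elv e c x \<longrightarrow> l2 x \<in> set (lab_lo e n nf f)"
      using lo_f[OF u(4), of n nf] 2 by auto
    let ?N = "Lab False False (nf \<and> \<not> contact e 0 s) (hgt e 0 s)"
    let ?ls = "if d = e then (case n of 0 \<Rightarrow> ?N # lab_hi e 0 s | Suc m \<Rightarrow> lab_lo e m False s)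
      else lab_lo e (Suc n) False s"
    have "\<exists>l1. (elv e c u = 1 \<longrightarrow> l1 u = ?N) \<and> goodlab e c a l1 (S w u) \<and>
        (\<forall>x\<in>S w u. 1 \<le> elv e c x \<longrightarrow> l1 x \<in> set ?ls)"
    proof (cases "d = e")
      case True
      show ?thesis
      proof (cases n)
        case 0
        then show ?thesis using hi_s[OF u(3), of 0 ?N] 2 eu True by (auto simp: Su)
      next
        case (Suc m)
        then show ?thesis using lo_s[OF u(3), of m False] 2 eu True by (auto simp: Su)
      qed
    next
      case False
      then show ?thesis using lo_s[OF u(3), of "Suc n" False] 2 eu by (auto simp: Su)
    qed
    then obtain l1 where l1: "elv e c u = 1 \<longrightarrow> l1 u = ?N" "goodlab e c a l1 (S w u)"
      "\<forall>x\<in>S w u. 1 \<le> elv e c x \<longrightarrow> l1 x \<in> set ?ls" by blast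
    obtain l where l: "goodlab e c a l (U w X)" "\<forall>x\<in>S w u. l x = l1 x" "\<forall>x\<in>U w (X - {u}). l x = l2 x"
      using goodlab_join[OF 2(2) u(1) l1(2) l2(1)] l1(1) 2(3,4) by auto
    have "\<forall>x\<in>U w X. 1 \<le> elv e c x \<longrightarrow> l x \<in> set (lab_lo e n nf (B d s f))"
      using l(2,3) l1(3) l2(2) U_remove[OF u(1)] by auto
    then show ?case using l(1) by blast
  qed
qed

lemmas labs_hi = labs_parts[THEN conjunct1, rule_format]
lemmas labs_lo = labs_parts[THEN conjunct2, rule_format]

text \<open>The part of the top vertex needs its own induction: contacts at \<open>a\<close> itself
  do not spoil \<open>lsingle\<close>, and only below the level 0 children of \<open>a\<close> can
  near parts arise.\<close>

lemma labs_top: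
  assumes "brs a X f" "X \<subseteq> nb a" "elv e c a = 1" "hgt e 0 f \<le> lht L"
    "lsingle L \<longrightarrow> \<not> top_contact e f" "\<not> lnear L"
  shows "\<exists>lb. lb a = L \<and> goodlab e c a lb (U a X) \<and>
    (\<forall>x\<in>U a X. 1 \<le> elv e c x \<longrightarrow> lb x = L \<or> lb x \<in> set (lab_top e f))"
  using assms
proof (induction f arbitrary: X)
  case E
  then show ?case using adj_neq by (intro exI[of _ "\<lambda>_. L"]) (auto simp: goodlab_def)
next
  case (B d s f)
  from B.prems(1) obtain u where u: "u \<in> X" "dr A d a u" "brs u (nb u - {a}) s" "brs a (X - {u}) f" by auto
  have Su: "S a u = U u (nb u - {a})" using S_decomp dr_adj u(2) by blast
  have eu: "elv e c u = (if d = e then 2 else 0)" using elv_dr[OF u(2), of e c] B.prems(3) by simp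
  obtain l2 where l2: "l2 a = L" "goodlab e c a l2 (U a (X - {u}))"
    "\<forall>x\<in>U a (X - {u}). 1 \<le> elv e c x \<longrightarrow> l2 x = L \<or> l2 x \<in> set (lab_top e f)"
    using B.IH(2)[OF u(4)] B.prems by auto
  let ?ls = "if d = e then lab_hi e 1 s else lab_lo e 0 True s"
  have "\<exists>l1. (1 \<le> elv e c u \<longrightarrow> l1 u = L) \<and> goodlab e c a l1 (S a u) \<and>
      (\<forall>x\<in>S a u. 1 \<le> elv e c x \<longrightarrow> l1 x = L \<or> l1 x \<in> set ?ls)"
  proof (cases "d = e")
    case True
    then show ?thesis using labs_hi[OF u(3), of e c 1 L a] B.prems eu by (auto simp: Su)
  next
    case False
    have "adj a u" using dr_adj u(2) by blast
    then show ?thesis using labs_lo[OF u(3), of e c 0 True a] B.prems eu False by (auto simp: Su)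
  qed
  then obtain l1 where l1: "1 \<le> elv e c u \<longrightarrow> l1 u = L" "goodlab e c a l1 (S a u)"
    "\<forall>x\<in>S a u. 1 \<le> elv e c x \<longrightarrow> l1 x = L \<or> l1 x \<in> set ?ls" by blast
  obtain l where l: "goodlab e c a l (U a X)" "\<forall>x\<in>S a u. l x = l1 x" "\<forall>x\<in>U a (X - {u}). l x = l2 x"
    using goodlab_join[OF B.prems(2) u(1) l1(2) l2(2)] l1(1) l2(1) B.prems(3,6) by auto
  have "l a = L" using l(3) l2(1) by simp
  moreover have "\<forall>x\<in>U a X. 1 \<le> elv e c x \<longrightarrow> l x = L \<or> l x \<in> set (lab_top e (B d s f))"
    using l(2,3) l1(3) l2(3) U_remove[OF u(1)] by auto
  ultimately show ?case using l(1) by blast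
qed

lemma labelling:
  assumes "dr A d c a" "brs a (nb a - {c}) s"
  shows "\<exists>lb. goodlab e c a lb (S c a) \<and> (\<forall>x\<in>S c a. 1 \<le> elv e c x \<longrightarrow> lb x \<in> set (labs e (d, s))) \<and>
    (elv e c a = 1 \<longrightarrow> lroot (lb a))"
proof -
  have Sa: "S c a = U a (nb a - {c})" using S_decomp dr_adj assms by blast
  have ea: "elv e c a = (if d = e then 1 else - 1)" using elv_dr[OF assms(1), of e c] by simp
  show ?thesis
  proof (cases "d = e")
    case True
    then show ?thesis
      using labs_top[OF assms(2), of e c "Lab True (\<not> top_contact e s) False (hgt e 0 s)"] ea
      by (auto simp: Sa)
  next
    case False
    then show ?thesis using labs_lo[OF assms(2), of e c 1 False a] ea by (auto simp: Sa)
  qed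
qed

lemma directed_path:
  "lo A w f \<Longrightarrow> w \<in> V \<Longrightarrow>
    \<exists>D. D 0 = w \<and> (\<forall>k \<le> dheight e f. D k \<in> V) \<and> (\<forall>k < dheight e f. dr A e (D k) (D (Suc k)))"
proof (induction f arbitrary: w)
  case E
  then show ?case by (intro exI[of _ "\<lambda>_. w"]) auto
next
  case (B d s f)
  show ?case
  proof (cases "d = e \<and> dheight e f < Suc (dheight e s)")
    case True
    then have h: "dheight e (B d s f) = Suc (dheight e s)" by simp
    obtain u where u: "dr A e w u" "lo A u s" using B.prems True by auto
    then obtain D where D: "D 0 = u" "\<forall>k \<le> dheight e s. D k \<in> V"
      "\<forall>k < dheight e s. dr A e (D k) (D (Suc k))" using B.IH(1)[of u] dr_V by blast
    let ?D = "\<lambda>k. case k of 0 \<Rightarrow> w | Suc j \<Rightarrow> D j"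
    have "\<forall>k \<le> Suc (dheight e s). ?D k \<in> V" using D B.prems by (auto split: nat.splits)
    moreover have "\<forall>k < Suc (dheight e s). dr A e (?D k) (?D (Suc k))"
      using D u(1) by (auto split: nat.splits)
    ultimately show ?thesis unfolding h by (intro exI[of _ ?D]) auto
  next
    case False
    then have "dheight e (B d s f) = dheight e f" by auto
    then show ?thesis using B.IH(2)[of w] B.prems by auto
  qed
qed

end

section \<open>Functions on triples from different arms\<close>

context otree
begin

lemma elv_Not: "elv (\<not> e) c x = - elv e c x"
  by (simp add: elv_def)

lemma elv_cong: "lev x = lev y \<Longrightarrow> elv e c x = elv e c y"
  by (simp add: elv_def)

lemma elv_adj_c: "adj c a \<Longrightarrow> elv e c a = 1 \<Longrightarrow> dr A (\<not> e) a c"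
  using dr_elv[of a c e c "\<not> e"] adj_sym by simp

lemma arm_neq_c: "adj c a \<Longrightarrow> x \<in> S c a \<Longrightarrow> x \<noteq> c"
  using S_notin adj_neq by metis

lemma arm_root: "adj c a \<Longrightarrow> x \<in> S c a \<Longrightarrow> adj x c \<Longrightarrow> x = a"
  using S_uniq[of c x a x] adj_sym by auto

lemma arm_step: "adj c a \<Longrightarrow> x \<in> S c a \<Longrightarrow> adj x y \<Longrightarrow> y \<noteq> c \<Longrightarrow> y \<in> S c a"
  using S_step arm_neq_c by metis

lemma goodlab_ht: "goodlab e c a lb W \<Longrightarrow> x \<in> W \<Longrightarrow> 1 \<le> elv e c x \<Longrightarrow> elv e c x \<le> int (lht (lb x))"
  by (simp add: goodlab_def)

lemma single_contact:
  assumes "adj c a" "goodlab e c a lb (S c a)" "x \<in> S c a" "elv e c x = 1" "adj x y" "elv e c y = 0"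
    "lsingle (lb x)"
  shows "dr A (\<not> e) x c"
proof -
  have "x = a"
  proof (cases "y = c")
    case True then show ?thesis using arm_root assms by blast
  next
    case False
    then have "y \<in> S c a" using arm_step assms by blast
    then show ?thesis using assms unfolding goodlab_def by blast
  qed
  then show ?thesis using elv_adj_c assms by blast
qed

lemma near_contact:
  assumes "adj c a" "goodlab e c a lb (S c a)" "x \<in> S c a" "elv e c x = 1" "adj x y" "elv e c y = 0"
    "lnear (lb x)" "y \<noteq> c"
  shows "adj a y \<and> elv e c a = 1"
proof -
  have "y \<in> S c a" using arm_step assms by blast
  then show ?thesis using assms unfolding goodlab_def by blast
qed

lemma label_const:
  assumes "adj c a" "goodlab e c a lb (S c a)" "x \<in> S c a" "adj x y" "1 \<le> elv e c x" "1 \<le> elv e c y"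
  shows "y \<in> S c a \<and> lb y = lb x"
proof -
  have "y \<noteq> c" using assms(6) by auto
  then have "y \<in> S c a" using arm_step assms by blast
  then show ?thesis using assms unfolding goodlab_def by metis
qed

text \<open>
  Level 0 is mapped to \<open>c\<close>. On either side, a coordinate in a part whose only contact is the top
  vertex can be used as a projection; if there is none, one of the parts is so low that the levels can be
  mapped to a directed path from \<open>c\<close>.
\<close>

lemma phi_z:
  assumes c: "c \<in> V" and a: "adj c a1" "adj c a2" "adj c a3"
    and g: "\<And>e. goodlab e c a1 (l1 e) (S c a1)" "\<And>e. goodlab e c a2 (l2 e) (S c a2)"
      "\<And>e. goodlab e c a3 (l3 e) (S c a3)"
    and D: "\<And>e. D e 0 = c" "\<And>e k. k \<le> h e \<Longrightarrow> D e k \<in> V" "\<And>e k. k < h e \<Longrightarrow> dr A e (D e k) (D e (Suc k))"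
    and z: "\<And>e x y z. \<lbrakk>x \<in> S c a1; y \<in> S c a2; z \<in> S c a3; 1 \<le> elv e c x; 1 \<le> elv e c y; 1 \<le> elv e c z\<rbrakk>
      \<Longrightarrow> zcond (h e) (l1 e x) (l2 e y) (l3 e z)"
  shows "\<exists>\<phi>. phi_ok c a1 a2 a3 \<phi>"
proof -
  \<comment> \<open>The order of preference depends only on labels. These are constant on parts, so
    the same alternative is taken along all arcs between positive levels.\<close>
  define \<psi> where "\<psi> e x y z = (if lsingle (l1 e x) then x else if lsingle (l2 e y) then y
    else if lsingle (l3 e z) then z else D e (nat (elv e c x)))" for e x y z
  define \<phi> where "\<phi> x y z = (if lev x = lev c then c else \<psi> (lev c < lev x) x y z)" for x y z
  have \<phi>0: "\<phi> x y z = c" if "elv e c x = 0" for e x y z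
    using that by (auto simp: \<phi>_def elv_def split: if_splits)
  have \<phi>1: "\<phi> x y z = \<psi> e x y z" if "1 \<le> elv e c x" for e x y z
    using that by (auto simp: \<phi>_def elv_def split: if_splits)
  have hb: "nat (elv e c x) \<le> h e"
    if "x \<in> S c a1" "y \<in> S c a2" "z \<in> S c a3" "1 \<le> elv e c x" "elv e c y = elv e c x" "elv e c z = elv e c x"
      "\<not> lsingle (l1 e x)" "\<not> lsingle (l2 e y)" "\<not> lsingle (l3 e z)" for e x y z
  proof -
    have "zcond (h e) (l1 e x) (l2 e y) (l3 e z)" using z that by simp
    then have "lht (l1 e x) \<le> h e \<or> lht (l2 e y) \<le> h e \<or> lht (l3 e z) \<le> h e"
      using that by (simp add: zcond_def)
    moreover have "elv e c x \<le> int (lht (l1 e x))" using goodlab_ht[OF g(1)[of e], of x] that by simp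
    moreover have "elv e c y \<le> int (lht (l2 e y))" using goodlab_ht[OF g(2)[of e], of y] that by simp
    moreover have "elv e c z \<le> int (lht (l3 e z))" using goodlab_ht[OF g(3)[of e], of z] that by simp
    ultimately show ?thesis using that(5,6) by linarith
  qed
  have ct: "dr A (\<not> e) (\<psi> e x y z) c"
    if xs: "x \<in> S c a1" "y \<in> S c a2" "z \<in> S c a3" "elv e c x = 1" "elv e c y = 1" "elv e c z = 1"
      and n: "adj x x'" "adj y y'" "adj z z'" "elv e c x' = 0" "elv e c y' = 0" "elv e c z' = 0"
    for e x y z x' y' z'
  proof -
    consider "lsingle (l1 e x)" | "\<not> lsingle (l1 e x)" "lsingle (l2 e y)"
      | "\<not> lsingle (l1 e x)" "\<not> lsingle (l2 e y)" "lsingle (l3 e z)"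
      | "\<not> lsingle (l1 e x)" "\<not> lsingle (l2 e y)" "\<not> lsingle (l3 e z)" by blast
    then show ?thesis
    proof cases
      case 1 then show ?thesis using single_contact[OF a(1) g(1) xs(1,4) n(1,4)] by (simp add: \<psi>_def)
    next
      case 2 then show ?thesis using single_contact[OF a(2) g(2) xs(2,5) n(2,5)] by (simp add: \<psi>_def)
    next
      case 3 then show ?thesis using single_contact[OF a(3) g(3) xs(3,6) n(3,6)] by (simp add: \<psi>_def)
    next
      case 4
      then have "0 < h e" using hb[OF xs(1-3), of e] xs by simp
      then show ?thesis using 4 D(3)[of 0 e] D(1) xs by (simp add: \<psi>_def)
    qed
  qed
  have "phi_ok c a1 a2 a3 \<phi>"
    unfolding phi_ok_def
  proof (intro ballI impI conjI allI)
    fix x y z assume xs: "x \<in> S c a1" "y \<in> S c a2" "z \<in> S c a3" and lv: "lev x = lev y \<and> lev x = lev z"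
    have e: "elv e c y = elv e c x" "elv e c z = elv e c x" for e using lv elv_cong by metis+
    have SV: "S c a1 \<subseteq> V" "S c a2 \<subseteq> V" "S c a3 \<subseteq> V" using S_sub a adj_V by blast+
    show "\<phi> x y z \<in> V"
    proof (cases "lev x = lev c")
      case True then show ?thesis using c by (simp add: \<phi>_def)
    next
      case False
      then have "1 \<le> elv (lev c < lev x) c x" by (auto simp: elv_def)
      then obtain e where p: "1 \<le> elv e c x" by blast
      then show ?thesis using \<phi>1[OF p] hb[OF xs p] e D(2) SV xs by (auto simp: \<psi>_def)
    qed
    fix d x' y' z' assume d: "dr A d x x' \<and> dr A d y y' \<and> dr A d z z'"
    have adjs: "adj x x'" "adj y y'" "adj z z'" using d dr_adj by blast+
    have el: "elv e c x' = elv e c x + (if d = e then 1 else - 1)"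
      "elv e c y' = elv e c x + (if d = e then 1 else - 1)"
      "elv e c z' = elv e c x + (if d = e then 1 else - 1)" for e
      using d elv_dr e by metis+
    have nc: "x \<noteq> c" "y \<noteq> c" "z \<noteq> c" using arm_neq_c a xs by blast+
    show "if x' = c \<or> y' = c \<or> z' = c then dr A d (\<phi> x y z) c else dr A d (\<phi> x y z) (\<phi> x' y' z')"
    proof (cases "elv d c x = 0")
      case True
      then have "elv d c x' = 1" "elv d c y' = 1" "elv d c z' = 1" using el[of d] by auto
      note e1 = this
      then have ncc: "x' \<noteq> c" "y' \<noteq> c" "z' \<noteq> c" by auto
      then have xs': "x' \<in> S c a1" "y' \<in> S c a2" "z' \<in> S c a3"
        using arm_step a xs adjs by blast+
      have "dr A (\<not> d) (\<psi> d x' y' z') c"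
        by (rule ct[OF xs' e1, of x y z]) (use adjs adj_sym True e[of d] in auto)
      then show ?thesis using \<phi>0[OF True] \<phi>1[of d x'] e1 ncc by simp
    next
      case nz: False
      show ?thesis
      proof (cases "elv (\<not> d) c x = 1")
        case True
        then have e0: "elv (\<not> d) c x' = 0" "elv (\<not> d) c y' = 0" "elv (\<not> d) c z' = 0" using el[of "\<not> d"] by auto
        have "dr A (\<not> \<not> d) (\<psi> (\<not> d) x y z) c"
          by (rule ct[OF xs, of _ x' y' z']) (use True e[of "\<not> d"] adjs e0 in auto)
        then show ?thesis using \<phi>0[OF e0(1)] \<phi>1[of "\<not> d" x] True by simp
      next
        case False
        obtain e where p: "1 \<le> elv e c x" "1 \<le> elv e c x'"
        proof -
          have "1 \<le> elv d c x \<or> 2 \<le> elv (\<not> d) c x" using nz False by (auto simp: elv_Not)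
          then show ?thesis using that[of d] that[of "\<not> d"] el by fastforce
        qed
        have p': "1 \<le> elv e c y'" "1 \<le> elv e c z'" "1 \<le> elv e c y" "1 \<le> elv e c z"
          using p el[of e] e[of e] by auto
        then have ncc: "x' \<noteq> c" "y' \<noteq> c" "z' \<noteq> c" using p by auto
        have c1: "x' \<in> S c a1 \<and> l1 e x' = l1 e x" using label_const[OF a(1) g(1) xs(1) adjs(1) p] .
        have c2: "y' \<in> S c a2 \<and> l2 e y' = l2 e y" using label_const[OF a(2) g(2) xs(2) adjs(2) p'(3,1)] .
        have c3: "z' \<in> S c a3 \<and> l3 e z' = l3 e z" using label_const[OF a(3) g(3) xs(3) adjs(3) p'(4,2)] .
        have "dr A d (\<psi> e x y z) (\<psi> e x' y' z')"
        proof (cases "lsingle (l1 e x) \<or> lsingle (l2 e y) \<or> lsingle (l3 e z)")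
          case True
          then show ?thesis using d c1 c2 c3 by (auto simp: \<psi>_def)
        next
          case False
          have h1: "nat (elv e c x) \<le> h e" using hb[OF xs p(1)] e False by auto
          have h2: "nat (elv e c x') \<le> h e" using hb[of x' y' z' e] c1 c2 c3 p(2) el[of e] False by auto
          have "dr A d (D e (nat (elv e c x))) (D e (nat (elv e c x')))"
          proof (cases "d = e")
            case True
            then have "nat (elv e c x') = Suc (nat (elv e c x))" using el[of e] p by simp
            then show ?thesis using D(3)[of "nat (elv e c x)" e] h2 True by simp
          next
            case False
            then have "nat (elv e c x) = Suc (nat (elv e c x'))" "d = (\<not> e)" using el[of e] p by auto
            then show ?thesis using D(3)[of "nat (elv e c x')" e] h1 by simp
          qed
          then show ?thesis using False c1 c2 c3 by (auto simp: \<psi>_def)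
        qed
        then show ?thesis using \<phi>1 p ncc by simp
      qed
    qed
  qed
  then show ?thesis by blast
qed

text \<open>
  The projection to \<open>x\<close> fails only if another coordinate steps to \<open>c\<close> while \<open>x\<close> is in a part away from
  the top vertex \<open>a1\<close>. If this part is near and some part has height 1, then \<open>a1\<close> serves as value.
\<close>

lemma phi_q:
  assumes c: "c \<in> V" and a: "adj c a1" "adj c a2" "adj c a3"
    and g: "\<And>e. goodlab e c a1 (l1 e) (S c a1)" "\<And>e. goodlab e c a2 (l2 e) (S c a2)"
      "\<And>e. goodlab e c a3 (l3 e) (S c a3)"
    and r: "\<And>e. elv e c a2 = 1 \<Longrightarrow> lroot (l2 e a2)" "\<And>e. elv e c a3 = 1 \<Longrightarrow> lroot (l3 e a3)"
    and q: "\<And>e x y z. \<lbrakk>x \<in> S c a1; y \<in> S c a2; z \<in> S c a3; 1 \<le> elv e c x; 1 \<le> elv e c y; 1 \<le> elv e c z\<rbrakk>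
      \<Longrightarrow> qcond (l1 e x) (l2 e y) (l3 e z)"
  shows "\<exists>\<phi>. phi_ok c a1 a2 a3 \<phi>"
proof -
  define keep where "keep e x y z \<longleftrightarrow> \<not> lroot (l2 e y) \<and> \<not> lroot (l3 e z) \<or> lsingle (l1 e x)" for e x y z
  define \<phi> where "\<phi> x y z = (if lev x = lev c \<or> keep (lev c < lev x) x y z then x else a1)" for x y z
  have \<phi>0: "\<phi> x y z = x" if "elv e c x = 0" for e x y z
    using that by (auto simp: \<phi>_def elv_def split: if_splits)
  have \<phi>1: "\<phi> x y z = (if keep e x y z then x else a1)" if "1 \<le> elv e c x" for e x y z
    using that by (cases e) (auto simp: \<phi>_def elv_def)
  \<comment> \<open>All coordinates have the same level, so a single part of height at most 1 forces
    level 1. The constant value \<open>a1\<close> thus never meets an arc between two positive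
    levels.\<close>
  have nk: "elv e c x = 1 \<and> lnear (l1 e x)"
    if "x \<in> S c a1" "y \<in> S c a2" "z \<in> S c a3" "1 \<le> elv e c x" "elv e c y = elv e c x" "elv e c z = elv e c x"
      "\<not> keep e x y z" for e x y z
  proof -
    have "qcond (l1 e x) (l2 e y) (l3 e z)" using q that by simp
    then have "lnear (l1 e x) \<and> (lht (l1 e x) \<le> 1 \<or> lht (l2 e y) \<le> 1 \<or> lht (l3 e z) \<le> 1)"
      using that(7) by (auto simp: qcond_def keep_def)
    moreover have "elv e c x \<le> int (lht (l1 e x))" using goodlab_ht[OF g(1)[of e], of x] that by simp
    moreover have "elv e c y \<le> int (lht (l2 e y))" using goodlab_ht[OF g(2)[of e], of y] that by simp
    moreover have "elv e c z \<le> int (lht (l3 e z))" using goodlab_ht[OF g(3)[of e], of z] that by simp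
    ultimately show ?thesis using that(4-6) by linarith
  qed
  have up: "dr A e w (\<phi> x y z)"
    if xs: "x \<in> S c a1" "y \<in> S c a2" "z \<in> S c a3" "elv e c x = 1" "elv e c y = 1" "elv e c z = 1"
      and n: "dr A e w x" "dr A e w2 y" "dr A e w3 z"
      and bd: "w \<noteq> c" for e x y z w w2 w3
  proof (cases "keep e x y z")
    case True then show ?thesis using \<phi>1[of e x] xs n by simp
  next
    case False
    have w0: "elv e c w = 0" using elv_dr[OF n(1), of e c] xs by simp
    have "adj a1 w \<and> elv e c a1 = 1"
      using near_contact[OF a(1) g(1) xs(1,4) _ w0 _ bd] nk[OF xs(1-3)] xs False dr_adj n(1) adj_sym by auto
    then have "dr A e w a1" using dr_elv[of w a1 e c e] w0 adj_sym by auto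
    then show ?thesis using \<phi>1[of e x] xs False by simp
  qed
  have bd: "dr A (\<not> e) (\<phi> x y z) c"
    if xs: "x \<in> S c a1" "y \<in> S c a2" "z \<in> S c a3" "elv e c x = 1" "elv e c y = 1" "elv e c z = 1"
      and n: "adj x x'" "adj y y'" "adj z z'" "elv e c x' = 0" "elv e c y' = 0" "elv e c z' = 0"
      and cc: "x' = c \<or> y' = c \<or> z' = c" for e x y z x' y' z'
  proof (cases "keep e x y z")
    case True
    have "dr A (\<not> e) x c"
    proof (cases "lsingle (l1 e x)")
      case True then show ?thesis using single_contact[OF a(1) g(1) xs(1,4) n(1,4)] by simp
    next
      case False
      then have nr: "\<not> lroot (l2 e y)" "\<not> lroot (l3 e z)" using True by (auto simp: keep_def)
      have "y' \<noteq> c"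
      proof
        assume "y' = c"
        then have "y = a2" using arm_root[OF a(2) xs(2)] n by simp
        then show False using r(1) nr xs by auto
      qed
      moreover have "z' \<noteq> c"
      proof
        assume "z' = c"
        then have "z = a3" using arm_root[OF a(3) xs(3)] n by simp
        then show False using r(2) nr xs by auto
      qed
      ultimately have "x' = c" using cc by blast
      then have "x = a1" using arm_root[OF a(1) xs(1)] n by simp
      then show ?thesis using elv_adj_c a(1) xs by simp
    qed
    then show ?thesis using \<phi>1[of e x] True xs by simp
  next
    case False
    have n': "lnear (l1 e x)" using nk[OF xs(1-3)] xs False by simp
    have "elv e c a1 = 1"
    proof (cases "x' = c")
      case True then show ?thesis using arm_root[OF a(1) xs(1)] n xs by simp
    next
      case False
      then show ?thesis using near_contact[OF a(1) g(1) xs(1,4) n(1,4) n'] by simp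
    qed
    then show ?thesis using \<phi>1[of e x] False xs elv_adj_c[OF a(1)] by simp
  qed
  have "phi_ok c a1 a2 a3 \<phi>"
    unfolding phi_ok_def
  proof (intro ballI impI conjI allI)
    fix x y z assume xs: "x \<in> S c a1" "y \<in> S c a2" "z \<in> S c a3" and lv: "lev x = lev y \<and> lev x = lev z"
    have e: "elv e c y = elv e c x" "elv e c z = elv e c x" for e using lv elv_cong by metis+
    have "S c a1 \<subseteq> V" using S_sub a adj_V by blast
    then show "\<phi> x y z \<in> V" using xs adj_V[OF a(1)] by (auto simp: \<phi>_def)
    fix d x' y' z' assume d: "dr A d x x' \<and> dr A d y y' \<and> dr A d z z'"
    have adjs: "adj x x'" "adj y y'" "adj z z'" using d dr_adj by blast+
    have el: "elv e c x' = elv e c x + (if d = e then 1 else - 1)"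
      "elv e c y' = elv e c x + (if d = e then 1 else - 1)"
      "elv e c z' = elv e c x + (if d = e then 1 else - 1)" for e
      using d elv_dr e by metis+
    have nc: "x \<noteq> c" "y \<noteq> c" "z \<noteq> c" using arm_neq_c a xs by blast+
    show "if x' = c \<or> y' = c \<or> z' = c then dr A d (\<phi> x y z) c else dr A d (\<phi> x y z) (\<phi> x' y' z')"
    proof (cases "elv d c x = 0")
      case True
      then have "elv d c x' = 1" "elv d c y' = 1" "elv d c z' = 1" using el[of d] by auto
      note e1 = this
      then have ncc: "x' \<noteq> c" "y' \<noteq> c" "z' \<noteq> c" by auto
      then have xs': "x' \<in> S c a1" "y' \<in> S c a2" "z' \<in> S c a3"
        using arm_step a xs adjs by blast+
      have "dr A d x (\<phi> x' y' z')" using up[OF xs' e1 _ _ _ nc(1)] d by blast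
      then show ?thesis using \<phi>0[OF True] ncc by simp
    next
      case nz: False
      show ?thesis
      proof (cases "elv (\<not> d) c x = 1")
        case True
        then have e0: "elv (\<not> d) c x' = 0" "elv (\<not> d) c y' = 0" "elv (\<not> d) c z' = 0" using el[of "\<not> d"] by auto
        have ones: "elv (\<not> d) c y = 1" "elv (\<not> d) c z = 1" using True e[of "\<not> d"] by auto
        show ?thesis
        proof (cases "x' = c \<or> y' = c \<or> z' = c")
          case cc: True
          then show ?thesis using bd[OF xs True ones adjs e0 cc] by auto
        next
          case False
          then have "dr A (\<not> d) x' (\<phi> x y z)" using up[OF xs True ones, of x' y' z'] d by auto
          then show ?thesis using False \<phi>0[OF e0(1)] by simp
        qed
      next
        case False
        obtain e where p: "1 \<le> elv e c x" "1 \<le> elv e c x'"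
        proof -
          have "1 \<le> elv d c x \<or> 2 \<le> elv (\<not> d) c x" using nz False by (auto simp: elv_Not)
          then show ?thesis using that[of d] that[of "\<not> d"] el by fastforce
        qed
        have p': "1 \<le> elv e c y'" "1 \<le> elv e c z'" "1 \<le> elv e c y" "1 \<le> elv e c z"
          using p el[of e] e[of e] by auto
        then have ncc: "x' \<noteq> c" "y' \<noteq> c" "z' \<noteq> c" using p by auto
        have c1: "x' \<in> S c a1 \<and> l1 e x' = l1 e x" using label_const[OF a(1) g(1) xs(1) adjs(1) p] .
        have c2: "y' \<in> S c a2 \<and> l2 e y' = l2 e y" using label_const[OF a(2) g(2) xs(2) adjs(2) p'(3,1)] .
        have c3: "z' \<in> S c a3 \<and> l3 e z' = l3 e z" using label_const[OF a(3) g(3) xs(3) adjs(3) p'(4,2)] .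
        have kk: "keep e x' y' z' = keep e x y z" using c1 c2 c3 by (simp add: keep_def)
        have "keep e x y z"
        proof (rule ccontr)
          assume k: "\<not> keep e x y z"
          have "elv e c x = 1" using nk[OF xs p(1)] e k by blast
          moreover have "elv e c x' = 1" using nk[of x' y' z' e] c1 c2 c3 p(2) el[of e] kk k by auto
          ultimately show False using el(1)[of e] by (auto split: if_splits)
        qed
        then show ?thesis using \<phi>1 p ncc kk d by simp
      qed
    qed
  qed
  then show ?thesis by blast
qed

end

section \<open>Exclusion of all other triples of arms\<close>

lemma lab_nonroot:
  "(\<forall>n. \<forall>l\<in>set (lab_hi e n f). \<not> lroot l) \<and> (\<forall>n nf. \<forall>l\<in>set (lab_lo e n nf f). \<not> lroot l)"
  by (induction f) (auto split: nat.splits)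

lemma good_iff:
  "good a b c \<longleftrightarrow> zgood a b c True \<and> zgood a b c False \<or> qgood a b c True \<and> qgood a b c False \<or>
     qgood b a c True \<and> qgood b a c False \<or> qgood c a b True \<and> qgood c a b False"
  by (simp add: good_def)

lemma zgood_iff: "zgood a b c e \<longleftrightarrow> (\<forall>k\<in>set (labs e a). \<forall>l\<in>set (labs e b). \<forall>m\<in>set (labs e c).
    zcond (dheight e (star3 a b c)) k l m)"
  by (simp add: zgood_def all3_def list_all_iff)

lemma qgood_iff: "qgood a b c e \<longleftrightarrow> (\<forall>k\<in>set (labs e a). \<forall>l\<in>set (labs e b). \<forall>m\<in>set (labs e c).
    qcond k l m)"
  by (simp add: qgood_def all3_def list_all_iff)

text \<open>A violation of \<open>qcond\<close> needs a part with a top vertex in the second or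
  third arm. On side \<open>e\<close> these arms have none, so the violation occurs on the other
  side.\<close>

lemma qbad:
  assumes "\<not> (qgood a b c True \<and> qgood a b c False)" "fst b \<noteq> e" "fst c \<noteq> e"
  shows "\<exists>l\<in>set (labs (\<not> e) a). \<not> lsingle l"
proof -
  obtain e' where "\<not> qgood a b c e'" using assms(1) by blast
  then obtain k l m where k: "k \<in> set (labs e' a)" "l \<in> set (labs e' b)" "m \<in> set (labs e' c)"
    "\<not> qcond k l m" by (auto simp: qgood_iff)
  have "lroot l \<or> lroot m" "\<not> lsingle k" using k(4) by (auto simp: qcond_def)
  moreover have "\<not> lroot l \<and> \<not> lroot m" if "e' = e"
    using k(2,3) assms(2,3) lab_nonroot that by (cases b; cases c) auto
  ultimately show ?thesis using k(1) by (cases "e' = e") auto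
qed

text \<open>A violation of \<open>zcond\<close> consists of three non-single parts higher than every
  directed path from \<open>c\<close> within the arms. If an arm starts on side \<open>e\<close>,
  such a path has length at least 1, whence \<open>1 < lht l\<close>; otherwise the failure of all
  three projections supplies non-single parts on the opposite side.\<close>

lemma not_good:
  assumes "\<not> good a b c"
  shows "\<exists>e. ((fst a = e \<or> fst b = e \<or> fst c = e) \<and>
       (\<forall>x\<in>{a, b, c}. \<exists>l\<in>set (labs e x). \<not> lsingle l \<and> 1 < lht l)) \<or> (\<forall>x\<in>{a, b, c}. arm0 e x)"
proof -
  obtain e where "\<not> zgood a b c e" using assms by (auto simp: good_iff)
  then obtain k l m where k: "k \<in> set (labs e a)" "l \<in> set (labs e b)" "m \<in> set (labs e c)"
    "\<not> zcond (dheight e (star3 a b c)) k l m" by (auto simp: zgood_iff)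
  show ?thesis
  proof (cases "fst a = e \<or> fst b = e \<or> fst c = e")
    case True
    then have "1 \<le> dheight e (star3 a b c)" by (auto simp: star3_def)
    then show ?thesis using True k by (intro exI[of _ e]) (auto simp: zcond_def)
  next
    case False
    have "\<exists>l\<in>set (labs (\<not> e) a). \<not> lsingle l" "\<exists>l\<in>set (labs (\<not> e) b). \<not> lsingle l"
      "\<exists>l\<in>set (labs (\<not> e) c). \<not> lsingle l"
      using qbad[of a b c e] qbad[of b a c e] qbad[of c a b e] assms False by (auto simp: good_iff)
    moreover have "\<not> lsingle k" "\<not> lsingle l" "\<not> lsingle m" using k(4) by (auto simp: zcond_def)
    ultimately show ?thesis using k(1-3) False
      by (intro exI[of _ e] disjI2) (auto simp: arm0_def list_ex_iff)
  qed
qed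

lemma pairs2D: "pairs2 P xs \<Longrightarrow> x \<in> set xs \<Longrightarrow> y \<in> set xs \<Longrightarrow> x \<noteq> y \<Longrightarrow> P x y \<or> P y x"
  by (induction xs) (auto simp: list_all_iff)

lemma trip3D:
  assumes "trip3 P xs" "x \<in> set xs" "y \<in> set xs" "z \<in> set xs" "x \<noteq> y" "x \<noteq> z" "y \<noteq> z"
  shows "P x y z \<or> P x z y \<or> P y x z \<or> P y z x \<or> P z x y \<or> P z y x"
  using assms
proof (induction xs)
  case (Cons w ws)
  consider "w = x" | "w = y" | "w = z" | "w \<notin> {x, y, z}" by blast
  then show ?case
  proof cases
    case 1 then show ?thesis using Cons.prems pairs2D[of "P x" ws y z] by auto
  next
    case 2 then show ?thesis using Cons.prems pairs2D[of "P y" ws x z] by auto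
  next
    case 3 then show ?thesis using Cons.prems pairs2D[of "P z" ws x y] by auto
  next
    case 4 then show ?thesis using Cons by auto
  qed
qed simp

lemma branches_mono: "set (branches m) \<subseteq> set (branches (m + k))"
proof (induction k)
  case (Suc k)
  have "set (branches (m + k)) \<subseteq> set (branches (Suc (m + k)))"
    by (simp only: branches.simps Let_def set_append) blast
  then show ?case using Suc by simp
qed simp

context otree
begin

lemma good_phi:
  assumes c: "c \<in> V" and d: "dr A (fst b1) c a1" "dr A (fst b2) c a2" "dr A (fst b3) c a3"
    and b: "brs a1 (nb a1 - {c}) (snd b1)" "brs a2 (nb a2 - {c}) (snd b2)" "brs a3 (nb a3 - {c}) (snd b3)"
    and good: "good b1 b2 b3"
  shows "\<exists>\<phi>. phi_ok c a1 a2 a3 \<phi>"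
proof -
  have a: "adj c a1" "adj c a2" "adj c a3" using d dr_adj by blast+
  obtain l1 where l1: "\<And>e. goodlab e c a1 (l1 e) (S c a1)"
    "\<And>e x. x \<in> S c a1 \<Longrightarrow> 1 \<le> elv e c x \<Longrightarrow> l1 e x \<in> set (labs e b1)"
    "\<And>e. elv e c a1 = 1 \<Longrightarrow> lroot (l1 e a1)"
    using labelling[OF d(1) b(1)] by (metis prod.collapse)
  obtain l2 where l2: "\<And>e. goodlab e c a2 (l2 e) (S c a2)"
    "\<And>e x. x \<in> S c a2 \<Longrightarrow> 1 \<le> elv e c x \<Longrightarrow> l2 e x \<in> set (labs e b2)"
    "\<And>e. elv e c a2 = 1 \<Longrightarrow> lroot (l2 e a2)"
    using labelling[OF d(2) b(2)] by (metis prod.collapse)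
  obtain l3 where l3: "\<And>e. goodlab e c a3 (l3 e) (S c a3)"
    "\<And>e x. x \<in> S c a3 \<Longrightarrow> 1 \<le> elv e c x \<Longrightarrow> l3 e x \<in> set (labs e b3)"
    "\<And>e. elv e c a3 = 1 \<Longrightarrow> lroot (l3 e a3)"
    using labelling[OF d(3) b(3)] by (metis prod.collapse)
  have q1: "\<exists>\<phi>. phi_ok c a1 a2 a3 \<phi>" if "qgood b1 b2 b3 True \<and> qgood b1 b2 b3 False"
  proof (rule phi_q[OF c a l1(1) l2(1) l3(1) l2(3) l3(3)])
    have "qgood b1 b2 b3 e" for e using that by (cases e) auto
    then show "qcond (l1 e x) (l2 e y) (l3 e z)"
      if "x \<in> S c a1" "y \<in> S c a2" "z \<in> S c a3" "1 \<le> elv e c x" "1 \<le> elv e c y" "1 \<le> elv e c z" for e x y z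
      using that l1(2) l2(2) l3(2) unfolding qgood_iff by blast
  qed
  have q2: "\<exists>\<phi>. phi_ok c a2 a1 a3 \<phi>" if "qgood b2 b1 b3 True \<and> qgood b2 b1 b3 False"
  proof (rule phi_q[OF c a(2,1,3) l2(1) l1(1) l3(1) l1(3) l3(3)])
    have "qgood b2 b1 b3 e" for e using that by (cases e) auto
    then show "qcond (l2 e x) (l1 e y) (l3 e z)"
      if "x \<in> S c a2" "y \<in> S c a1" "z \<in> S c a3" "1 \<le> elv e c x" "1 \<le> elv e c y" "1 \<le> elv e c z" for e x y z
      using that l1(2) l2(2) l3(2) unfolding qgood_iff by blast
  qed
  have q3: "\<exists>\<phi>. phi_ok c a3 a1 a2 \<phi>" if "qgood b3 b1 b2 True \<and> qgood b3 b1 b2 False"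
  proof (rule phi_q[OF c a(3,1,2) l3(1) l1(1) l2(1) l1(3) l2(3)])
    have "qgood b3 b1 b2 e" for e using that by (cases e) auto
    then show "qcond (l3 e x) (l1 e y) (l2 e z)"
      if "x \<in> S c a3" "y \<in> S c a1" "z \<in> S c a2" "1 \<le> elv e c x" "1 \<le> elv e c y" "1 \<le> elv e c z" for e x y z
      using that l1(2) l2(2) l3(2) unfolding qgood_iff by blast
  qed
  have zz: "\<exists>\<phi>. phi_ok c a1 a2 a3 \<phi>" if "zgood b1 b2 b3 True \<and> zgood b1 b2 b3 False"
  proof -
    have "lo A c (star3 b1 b2 b3)" using d b brs_lo by (auto simp: star3_def)
    then obtain D where D: "\<And>e. D e 0 = c" "\<And>e k. k \<le> dheight e (star3 b1 b2 b3) \<Longrightarrow> D e k \<in> V"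
      "\<And>e k. k < dheight e (star3 b1 b2 b3) \<Longrightarrow> dr A e (D e k) (D e (Suc k))"
      using directed_path[OF _ c] by metis
    show ?thesis
    proof (rule phi_z[OF c a l1(1) l2(1) l3(1) D])
      have "zgood b1 b2 b3 e" for e using that by (cases e) auto
      then show "zcond (dheight e (star3 b1 b2 b3)) (l1 e x) (l2 e y) (l3 e z)"
        if "x \<in> S c a1" "y \<in> S c a2" "z \<in> S c a3" "1 \<le> elv e c x" "1 \<le> elv e c y" "1 \<le> elv e c z" for e x y z
        using that l1(2) l2(2) l3(2) unfolding zgood_iff by blast
    qed
  qed
  show ?thesis
    using good q1 q2 q3 zz phi_ok_swap12 phi_ok_swap23 unfolding good_iff by metis
qed

lemma brs_picks:
  "brs w X R \<Longrightarrow> ((d, s), g) \<in> set (picks R) \<Longrightarrow>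
    \<exists>u\<in>X. dr A d w u \<and> brs u (nb u - {w}) s \<and> brs w (X - {u}) g"
proof (induction R arbitrary: X g)
  case (B e t R)
  from B.prems(1) obtain v where v: "v \<in> X" "dr A e w v" "brs v (nb v - {w}) t" "brs w (X - {v}) R" by auto
  from B.prems(2) consider "d = e" "s = t" "g = R" | g' where "((d, s), g') \<in> set (picks R)" "g = B e t g'"
    by auto
  then show ?case
  proof cases
    case 1 then show ?thesis using v by blast
  next
    case 2
    then obtain u where u: "u \<in> X - {v}" "dr A d w u" "brs u (nb u - {w}) s" "brs w (X - {v} - {u}) g'"
      using B.IH(2)[OF v(4)] by blast
    have "X - {v} - {u} = X - {u} - {v}" by blast
    then show ?thesis using u v 2 by (intro bexI[of _ u]) auto
  qed
qed simp

text \<open>\<open>foldfree\<close> tries to fold only branches that avoid the root. A change of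
  root brings the branch containing the old root within its reach.\<close>

lemma brs_reroot:
  assumes "brs c (nb c) R" "((d, s), g) \<in> set (picks R)"
  shows "\<exists>u. brs u (nb u) (B (\<not> d) g s)"
proof -
  obtain u where u: "dr A d c u" "brs u (nb u - {c}) s" "brs c (nb c - {u}) g"
    using brs_picks[OF assms] by blast
  have "c \<in> nb u" using dr_adj[OF u(1)] adj_sym by (auto simp: nb_def)
  then show ?thesis using u by (intro exI[of _ u]) auto
qed

end

context core_otree
begin

text \<open>Since a branch has several codes, differing in the order of siblings, one and the same
  \<open>s\<close> has to serve both bounds; the smaller applicable one is used and
  \<open>branches_mono\<close> gives the other.\<close>

lemma arm_rep:
  assumes "adj v w"
  shows "\<exists>s. brs w (nb w - {v}) s \<and> (card (S v w) \<le> 3 \<longrightarrow> (\<forall>d. (d, s) \<in> set (branches 3))) \<and>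
    (card (S v w) \<le> 7 \<longrightarrow> (\<forall>d. (d, s) \<in> set (branches 7)))"
proof -
  have sub: "set (branches 3) \<subseteq> set (branches 7)" using branches_mono[of 3 4] by simp
  consider "card (S v w) \<le> 3" | "card (S v w) \<le> 7" "\<not> card (S v w) \<le> 3" | "\<not> card (S v w) \<le> 7" by linarith
  then show ?thesis
  proof cases
    case 1 then show ?thesis using branches_complete[OF assms 1] sub by blast
  next
    case 2 then show ?thesis using branches_complete[OF assms 2(1)] by blast
  next
    case 3 then show ?thesis using brs_ex[of w "nb w - {v}"] adj_V[OF assms] by auto
  qed
qed

lemma same_branch:
  assumes "dr A d c x" "dr A d' c y" "brs x (nb x - {c}) s" "brs y (nb y - {c}) s'" "(d, s) = (d', s')"
  shows "x = y"
proof (rule ccontr)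
  assume ne: "x \<noteq> y"
  have e: "d' = d" "s' = s" using assms(5) by simp_all
  show False using no_fold[OF assms(1) assms(2)[unfolded e] ne assms(3)] brs_lo[OF assms(4)[unfolded e]] .
qed

lemma no_second:
  assumes "brs c (nb c) (star3 a b (d, B d' s E))"
    and "\<not> foldfree (B (\<not> d') (B (\<not> d) (B (fst a) (snd a) (B (fst b) (snd b) E)) E) s) E"
  shows False
proof -
  define g where "g = B (fst a) (snd a) (B (fst b) (snd b) E)"
  have "((d, B d' s E), g) \<in> set (picks (star3 a b (d, B d' s E)))" by (simp add: star3_def g_def)
  then obtain u where u: "brs u (nb u) (B (\<not> d) g (B d' s E))" using brs_reroot[OF assms(1)] by blast
  have "((d', s), B (\<not> d) g E) \<in> set (picks (B (\<not> d) g (B d' s E)))" by simp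
  then obtain v where v: "brs v (nb v) (B (\<not> d') (B (\<not> d) g E) s)" using brs_reroot[OF u] by blast
  then show False using foldfree_sound[OF v subset_refl, of "{}" E] assms(2) by (simp add: g_def del: foldfree.simps)
qed

lemma exceptional_sz: "f \<in> set (exceptional e) \<Longrightarrow> sz f = 15"
  by (cases e) (auto simp: exceptional_def star3_def)

text \<open>The second vertex on the third arm starts a directed path with four arcs. Relative to
  it, the branch containing the centre has only the levels 1 to 4 in the direction of this path, so
  it folds onto the path; \<open>no_second\<close> finds this after two changes of root.\<close>

lemma exceptional_second:
  assumes "brs c (nb c) f" "f \<in> set (exceptional e)"
  shows "f = hd (exceptional e)"
proof (rule ccontr)
  assume "f \<noteq> hd (exceptional e)"
  then have f: "f = exceptional e ! 1" using assms(2) by (cases e) (auto simp: exceptional_def)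
  show False
  proof (cases e)
    case True
    then have "brs c (nb c) (star3 (False, B True (B True (B True E E) E) E)
       (True, B False (B False E (B True (B True E E) E)) E)
       (False, B False (B True (B True (B True (B True E E) E) E) E) E))"
      using assms(1) f by (simp add: exceptional_def del: brs.simps)
    then show False by (rule no_second) code_simp
  next
    case False
    then have "brs c (nb c) (star3 (True, B False (B False (B False E E) E) E)
       (False, B True (B True E (B False (B False E E) E)) E)
       (True, B True (B False (B False (B False (B False E E) E) E) E) E))"
      using assms(1) f by (simp add: exceptional_def del: brs.simps)
    then show False by (rule no_second) code_simp
  qed
qed

lemma settled_exceptional:
  assumes V: "card V \<le> 16" and c: "c \<in> V"
    and d: "dr A (fst b1) c a1" "dr A (fst b2) c a2" "dr A (fst b3) c a3"
    and b: "brs a1 (nb a1 - {c}) (snd b1)" "brs a2 (nb a2 - {c}) (snd b2)" "brs a3 (nb a3 - {c}) (snd b3)"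
    and ne: "a1 \<noteq> a2" "a1 \<noteq> a3" "a2 \<noteq> a3"
    and bad: "\<not> (\<exists>\<phi>. phi_ok c a1 a2 a3 \<phi>)"
  shows "settled0 b1 b2 b3 \<Longrightarrow> False"
    and "settled e b1 b2 b3 \<Longrightarrow> fst b1 = e \<or> fst b2 = e \<or> fst b3 = e \<Longrightarrow>
      brs c (nb c) (hd (exceptional e)) \<and> card V = 16"
proof -
  have ng: "\<not> good b1 b2 b3" using good_phi[OF c d b] bad by blast
  have sub: "{a1, a2, a3} \<subseteq> nb c" using d dr_adj by (auto simp: nb_def)
  have br: "brs c {a1, a2, a3} (star3 b1 b2 b3)"
    using d b ne by (auto simp: star3_def insert_Diff_if)
  have card: "card (U c {a1, a2, a3}) = Suc (sz (star3 b1 b2 b3))" using brs_card[OF br c sub] .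
  moreover have "card (U c {a1, a2, a3}) \<le> card V" using U_sub[OF c sub] fin card_mono by blast
  ultimately have sz: "sz (star3 b1 b2 b3) \<le> 15" using V by simp
  then show False if "settled0 b1 b2 b3" using that ng by (simp add: settled0_def)
  assume s: "settled e b1 b2 b3" "fst b1 = e \<or> fst b2 = e \<or> fst b3 = e"
  have "foldfree (star3 b1 b2 b3) E" by (rule foldfree_sound[OF br sub, of "{}"]) auto
  then have ex: "star3 b1 b2 b3 \<in> set (exceptional e)"
    using s sz ng by (auto simp: settled_def split: if_splits)
  \<comment> \<open>The centre and the three arms already exhaust the 16 vertices, so there is no
    fourth branch at \<open>c\<close>.\<close>
  then have "card (U c {a1, a2, a3}) = 16" using card exceptional_sz by simp
  then have eq: "U c {a1, a2, a3} = V" "card V = 16"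
    using card_subset_eq[OF fin U_sub[OF c sub]] V card_mono[OF fin U_sub[OF c sub]] by auto
  have "nb c = {a1, a2, a3}"
  proof (rule ccontr)
    assume "nb c \<noteq> {a1, a2, a3}"
    then obtain u where u: "u \<in> nb c" "u \<notin> {a1, a2, a3}" using sub by blast
    then have "u \<in> U c {a1, a2, a3}" "u \<noteq> c" using eq nb_V adj_neq by (auto simp: nb_def)
    then obtain a where "a \<in> {a1, a2, a3}" "u \<in> S c a" by (auto simp: U_def)
    then have "u = a" using arm_root[of c a u] u sub adj_sym by (auto simp: nb_def)
    then show False using u \<open>a \<in> _\<close> by blast
  qed
  then have "brs c (nb c) (star3 b1 b2 b3)" using br by simp
  then show "brs c (nb c) (hd (exceptional e)) \<and> card V = 16"
    using exceptional_second ex eq by metis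
qed

theorem exceptional_if_no_majority:
  assumes V: "card V \<le> 16" and nomaj: "\<not> (\<exists>F. majority3 F)"
    and small: "\<And>e. filter (arm1 e) (branches 3) = []" "\<And>e. filter (arm0 e) (branches 3) = []"
    and chk: "\<And>e. trip3 (settled e) (filter (arm1 e) (branches 7))"
      "\<And>e. trip3 settled0 (filter (arm0 e) (branches 7))"
  shows "\<exists>e c. c \<in> V \<and> brs c (nb c) (hd (exceptional e)) \<and> card V = 16"
proof -
  obtain c a1 a2 a3 where c: "c \<in> V" and a: "a1 \<in> nb c" "a2 \<in> nb c" "a3 \<in> nb c"
    and ne: "a1 \<noteq> a2" "a1 \<noteq> a3" "a2 \<noteq> a3" and bad: "\<not> (\<exists>\<phi>. phi_ok c a1 a2 a3 \<phi>)"
    using majority_if_phi nomaj by blast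
  have adj: "adj c a1" "adj c a2" "adj c a3" using a by (auto simp: nb_def)
  obtain d1 d2 d3 where d: "dr A d1 c a1" "dr A d2 c a2" "dr A d3 c a3" using adj adj_dr by meson
  obtain s1 where s1: "brs a1 (nb a1 - {c}) s1" "card (S c a1) \<le> 3 \<longrightarrow> (\<forall>d. (d, s1) \<in> set (branches 3))"
    "card (S c a1) \<le> 7 \<longrightarrow> (\<forall>d. (d, s1) \<in> set (branches 7))" using arm_rep[OF adj(1)] by blast
  obtain s2 where s2: "brs a2 (nb a2 - {c}) s2" "card (S c a2) \<le> 3 \<longrightarrow> (\<forall>d. (d, s2) \<in> set (branches 3))"
    "card (S c a2) \<le> 7 \<longrightarrow> (\<forall>d. (d, s2) \<in> set (branches 7))" using arm_rep[OF adj(2)] by blast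
  obtain s3 where s3: "brs a3 (nb a3 - {c}) s3" "card (S c a3) \<le> 3 \<longrightarrow> (\<forall>d. (d, s3) \<in> set (branches 3))"
    "card (S c a3) \<le> 7 \<longrightarrow> (\<forall>d. (d, s3) \<in> set (branches 7))" using arm_rep[OF adj(3)] by blast
  let ?b1 = "(d1, s1)" and ?b2 = "(d2, s2)" and ?b3 = "(d3, s3)"
  have db: "?b1 \<noteq> ?b2" "?b1 \<noteq> ?b3" "?b2 \<noteq> ?b3"
    using same_branch[OF d(1,2) s1(1) s2(1)] same_branch[OF d(1,3) s1(1) s3(1)]
      same_branch[OF d(2,3) s2(1) s3(1)] ne by blast+
  have S: "card (S c a1) = Suc (sz s1)" "card (S c a2) = Suc (sz s2)" "card (S c a3) = Suc (sz s3)"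
    using brs_card[OF s1(1)] brs_card[OF s2(1)] brs_card[OF s3(1)] S_decomp[OF adj(1)] S_decomp[OF adj(2)]
      S_decomp[OF adj(3)] adj_V adj by auto
  have "brs c {a1, a2, a3} (star3 ?b1 ?b2 ?b3)"
    using d s1(1) s2(1) s3(1) ne by (auto simp: star3_def insert_Diff_if)
  then have "card (U c {a1, a2, a3}) = Suc (sz (star3 ?b1 ?b2 ?b3))" using brs_card c a by simp
  moreover have "card (U c {a1, a2, a3}) \<le> card V"
    using U_sub[OF c, of "{a1, a2, a3}"] a fin card_mono by blast
  ultimately have sum: "card (S c a1) + card (S c a2) + card (S c a3) \<le> 15"
    using V S by (simp add: star3_def)
  note sw = phi_ok_swap12 phi_ok_swap23
  have ne': "a2 \<noteq> a1" "a3 \<noteq> a1" "a3 \<noteq> a2" using ne by blast+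
  have bads: "\<not> (\<exists>\<phi>. phi_ok c a1 a3 a2 \<phi>)" "\<not> (\<exists>\<phi>. phi_ok c a2 a1 a3 \<phi>)" "\<not> (\<exists>\<phi>. phi_ok c a2 a3 a1 \<phi>)"
    "\<not> (\<exists>\<phi>. phi_ok c a3 a1 a2 \<phi>)" "\<not> (\<exists>\<phi>. phi_ok c a3 a2 a1 \<phi>)"
    using bad sw by metis+
  have inF: "?b1 \<in> set (filter P (branches 7)) \<and> ?b2 \<in> set (filter P (branches 7)) \<and>
      ?b3 \<in> set (filter P (branches 7))"
    if P: "P ?b1" "P ?b2" "P ?b3" and none: "filter P (branches 3) = []" for P
  proof -
    have no: "b \<notin> set (branches 3)" if "P b" for b
      using none that by (metis filter_empty_conv)
    have "\<not> card (S c a1) \<le> 3" "\<not> card (S c a2) \<le> 3" "\<not> card (S c a3) \<le> 3"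
      using no[OF P(1)] no[OF P(2)] no[OF P(3)] s1(2) s2(2) s3(2) by blast+
    then have "card (S c a1) \<le> 7" "card (S c a2) \<le> 7" "card (S c a3) \<le> 7" using sum by auto
    then show ?thesis using P s1(3) s2(3) s3(3) by simp
  qed
  have ng: "\<not> good ?b1 ?b2 ?b3" using good_phi[of c ?b1 a1 ?b2 a2 ?b3 a3] c d s1(1) s2(1) s3(1) bad by auto
  obtain e where e: "((fst ?b1 = e \<or> fst ?b2 = e \<or> fst ?b3 = e) \<and>
       (\<forall>x\<in>{?b1, ?b2, ?b3}. \<exists>l\<in>set (labs e x). \<not> lsingle l \<and> 1 < lht l)) \<or> (\<forall>x\<in>{?b1, ?b2, ?b3}. arm0 e x)"
    using not_good[OF ng] by (elim exE)
  show ?thesis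
  proof (cases "\<forall>x\<in>{?b1, ?b2, ?b3}. arm0 e x")
    case True
    then have "settled0 ?b1 ?b2 ?b3 \<or> settled0 ?b1 ?b3 ?b2 \<or> settled0 ?b2 ?b1 ?b3 \<or> settled0 ?b2 ?b3 ?b1 \<or>
        settled0 ?b3 ?b1 ?b2 \<or> settled0 ?b3 ?b2 ?b1"
      using trip3D[OF chk(2)[of e] _ _ _ db] inF[of "arm0 e"] small(2) by blast
    then have False
    proof (elim disjE)
      assume "settled0 ?b1 ?b2 ?b3"
      show False
        by (rule settled_exceptional(1)[OF V c, of ?b1 a1 ?b2 a2 ?b3 a3]; (unfold fst_conv snd_conv)?; fact)
    next
      assume "settled0 ?b1 ?b3 ?b2"
      show False
        by (rule settled_exceptional(1)[OF V c, of ?b1 a1 ?b3 a3 ?b2 a2]; (unfold fst_conv snd_conv)?; fact)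
    next
      assume "settled0 ?b2 ?b1 ?b3"
      show False
        by (rule settled_exceptional(1)[OF V c, of ?b2 a2 ?b1 a1 ?b3 a3]; (unfold fst_conv snd_conv)?; fact)
    next
      assume "settled0 ?b2 ?b3 ?b1"
      show False
        by (rule settled_exceptional(1)[OF V c, of ?b2 a2 ?b3 a3 ?b1 a1]; (unfold fst_conv snd_conv)?; fact)
    next
      assume "settled0 ?b3 ?b1 ?b2"
      show False
        by (rule settled_exceptional(1)[OF V c, of ?b3 a3 ?b1 a1 ?b2 a2]; (unfold fst_conv snd_conv)?; fact)
    next
      assume "settled0 ?b3 ?b2 ?b1"
      show False
        by (rule settled_exceptional(1)[OF V c, of ?b3 a3 ?b2 a2 ?b1 a1]; (unfold fst_conv snd_conv)?; fact)
    qed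
    then show ?thesis ..
  next
    case False
    then have dir: "d1 = e \<or> d2 = e \<or> d3 = e"
      and l: "\<forall>x\<in>{?b1, ?b2, ?b3}. \<exists>l\<in>set (labs e x). \<not> lsingle l \<and> 1 < lht l"
      using e unfolding fst_conv by blast+
    have dirs: "d1 = e \<or> d3 = e \<or> d2 = e" "d2 = e \<or> d1 = e \<or> d3 = e" "d2 = e \<or> d3 = e \<or> d1 = e"
      "d3 = e \<or> d1 = e \<or> d2 = e" "d3 = e \<or> d2 = e \<or> d1 = e" using dir by blast+
    \<comment> \<open>This neighbour makes \<open>B e E E\<close> a valid description of what lies
      around \<open>c\<close>, which is all that \<open>arm1\<close> assumes about the tree outside
      the arm.\<close>
    obtain w where w: "dr A e c w" using dir d by (elim disjE) (simp_all only:)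
    have ff: "foldfree s (B (\<not> d) (B e E E) E)" if "dr A d c a" "brs a (nb a - {c}) s" for d a s
      by (rule foldfree_sound[OF that(2), of "{c}"]) (use that w in auto)
    have "arm1 e ?b1" "arm1 e ?b2" "arm1 e ?b3"
      using l ff[OF d(1) s1(1)] ff[OF d(2) s2(1)] ff[OF d(3) s3(1)] by (auto simp: arm1_def list_ex_iff)
    then have "settled e ?b1 ?b2 ?b3 \<or> settled e ?b1 ?b3 ?b2 \<or> settled e ?b2 ?b1 ?b3 \<or> settled e ?b2 ?b3 ?b1 \<or>
        settled e ?b3 ?b1 ?b2 \<or> settled e ?b3 ?b2 ?b1"
      using trip3D[OF chk(1)[of e] _ _ _ db] inF[of "arm1 e"] small(1) by blast
    then have "brs c (nb c) (hd (exceptional e)) \<and> card V = 16"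
    proof (elim disjE)
      assume "settled e ?b1 ?b2 ?b3"
      show ?thesis
        by (rule settled_exceptional(2)[OF V c, of ?b1 a1 ?b2 a2 ?b3 a3]; (unfold fst_conv snd_conv)?; fact)
    next
      assume "settled e ?b1 ?b3 ?b2"
      show ?thesis
        by (rule settled_exceptional(2)[OF V c, of ?b1 a1 ?b3 a3 ?b2 a2]; (unfold fst_conv snd_conv)?; fact)
    next
      assume "settled e ?b2 ?b1 ?b3"
      show ?thesis
        by (rule settled_exceptional(2)[OF V c, of ?b2 a2 ?b1 a1 ?b3 a3]; (unfold fst_conv snd_conv)?; fact)
    next
      assume "settled e ?b2 ?b3 ?b1"
      show ?thesis
        by (rule settled_exceptional(2)[OF V c, of ?b2 a2 ?b3 a3 ?b1 a1]; (unfold fst_conv snd_conv)?; fact)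
    next
      assume "settled e ?b3 ?b1 ?b2"
      show ?thesis
        by (rule settled_exceptional(2)[OF V c, of ?b3 a3 ?b1 a1 ?b2 a2]; (unfold fst_conv snd_conv)?; fact)
    next
      assume "settled e ?b3 ?b2 ?b1"
      show ?thesis
        by (rule settled_exceptional(2)[OF V c, of ?b3 a3 ?b2 a2 ?b1 a1]; (unfold fst_conv snd_conv)?; fact)
    qed
    then show ?thesis using c by blast
  qed
qed

end

section \<open>The two exceptional trees\<close>

lemma with_proj_awalk_avoiding:
  assumes "pair_graph U" "(w, x) \<in> {(x, y). (x, y) \<in> parcs U \<and> x \<noteq> v \<and> y \<noteq> v}\<^sup>*" "w \<in> pverts U"
  shows "\<exists>p. pre_digraph.awalk (with_proj U) w p x \<and> (\<forall>e\<in>set p. snd e \<noteq> v)"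
proof -
  interpret pair_graph U by fact
  from assms(2) show ?thesis
  proof (induction rule: rtrancl_induct)
    case base
    then show ?case using assms(3) by (intro exI[of _ "[]"]) (simp add: awalk_Nil_iff)
  next
    case (step y z)
    then obtain p where p: "awalk w p y" "\<forall>e\<in>set p. snd e \<noteq> v" by blast
    have yz: "(y, z) \<in> parcs U" using step(2) by simp
    then have "awalk y [(y, z)] z" using in_arcsD2[OF yz] by (simp add: awalk_simps)
    then have "awalk w (p @ [(y, z)]) z" using p(1) by (rule awalk_appendI[rotated])
    then show ?case using p(2) step(2) by (intro exI[of _ "p @ [(y, z)]"]) auto
  qed
qed

text \<open>A path from \<open>w\<close> to \<open>w'\<close> that avoids \<open>v\<close> closes up
  through \<open>v\<close> to a cycle, of length at least 3 since \<open>w\<close> and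
  \<open>w'\<close> differ.\<close>

lemma tree_acyclic:
  assumes "undirected_tree U" "(v, w) \<in> parcs U" "(v, w') \<in> parcs U"
    and "(w, w') \<in> {(x, y). (x, y) \<in> parcs U \<and> x \<noteq> v \<and> y \<noteq> v}\<^sup>*"
  shows "w = w'"
proof (rule ccontr)
  assume ne: "w \<noteq> w'"
  have U: "pair_graph U" using assms(1) by (simp add: undirected_tree_def)
  interpret pair_graph U by fact
  have wV: "w \<in> pverts U" "w' \<in> pverts U" "v \<in> pverts U" using assms in_arcsD1 in_arcsD2 by blast+
  have wv: "w \<noteq> v" "w' \<noteq> v" using assms pair_no_loops by fastforce+
  have rev: "(w', v) \<in> parcs U" using assms(3) pair_sym_arcs by (auto simp: symmetric_def sym_def)
  obtain p where p: "awalk w p w'" "\<forall>e\<in>set p. snd e \<noteq> v"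
    using with_proj_awalk_avoiding[OF U assms(4) wV(1)] by blast
  define q where "q = awalk_to_apath p"
  have q: "apath w q w'" using apath_awalk_to_apath[OF p(1)] by (simp add: q_def)
  have qs: "set q \<subseteq> set p" using awalk_to_apath_subset[OF p(1)] by (simp add: q_def)
  have qa: "awalk w q w'" "distinct (pawalk_verts w q)" using q by (auto simp: apath_def)
  have qne: "q \<noteq> []" using qa(1) ne by (auto simp: awalk_simps)
  have vn: "v \<notin> set (pawalk_verts w q)"
    using qa(1) qs p(2) wv(1) awalk_verts_conv'[of w q w'] by (auto simp: awalk_def cas_simp)
  let ?c = "(v, w) # q @ [(w', v)]"
  have "awalk w (q @ [(w', v)]) v"
    using qa(1) rev wV by (intro awalk_appendI[OF qa(1)]) (simp add: awalk_simps)
  moreover from this have "pawalk_verts w (q @ [(w', v)]) = pawalk_verts w q @ [v]"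
    by (subst awalk_verts_append) auto
  ultimately have "pre_digraph.cycle (with_proj U) ?c"
    unfolding cycle_def using assms(2) wV vn qa by (intro exI[of _ v]) (simp add: awalk_simps)
  moreover have "length ?c \<ge> 3" using qne by (cases q) auto
  ultimately show False using assms(1) unfolding undirected_tree_def by blast
qed

lemma oriented_tree_otree:
  assumes "oriented_tree G"
  shows "otree (pverts G) (parcs G)"
proof -
  obtain U where U: "undirected_tree U" and o: "orientation_of G U" using assms by (auto simp: oriented_tree_def)
  then have pg: "pair_graph U" and cn: "connected (with_proj U)" by (auto simp: undirected_tree_def)
  interpret pair_graph U by fact
  have sym: "(y, x) \<in> parcs U" if "(x, y) \<in> parcs U" for x y
    using that pair_sym_arcs by (auto simp: symmetric_def sym_def)
  have adj: "adjr (parcs G) x y \<longleftrightarrow> (x, y) \<in> parcs U" for x y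
    using o sym unfolding orientation_of_def adjr_def by blast
  have sc: "strongly_connected (with_proj U)"
    using symmetric_connected_imp_strongly_connected[OF pair_sym_arcs cn] .
  show ?thesis
  proof
    show "finite (pverts G)" using o pair_finite_verts by (simp add: orientation_of_def)
    show "pverts G \<noteq> {}" using sc o by (auto simp: strongly_connected_def orientation_of_def)
    show "parcs G \<subseteq> pverts G \<times> pverts G"
      using o in_arcsD1 in_arcsD2 unfolding orientation_of_def by auto
    show "(y, x) \<notin> parcs G" if "(x, y) \<in> parcs G" for x y
      using o that unfolding orientation_of_def by blast
    show "(x, y) \<in> {(x, y). adjr (parcs G) x y}\<^sup>*" if "x \<in> pverts G" "y \<in> pverts G" for x y
    proof -
      have "x \<rightarrow>\<^sup>*\<^bsub>with_proj U\<^esub> y" using sc that o by (auto simp: strongly_connected_def orientation_of_def)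
      then have "(x, y) \<in> (parcs U)\<^sup>*" using reachable_rtranclI by fastforce
      then show ?thesis using adj by simp
    qed
    show "w = w'" if "adjr (parcs G) v w" "adjr (parcs G) v w'"
      "(w, w') \<in> {(x, y). adjr (parcs G) x y \<and> x \<noteq> v \<and> y \<noteq> v}\<^sup>*" for v w w'
      using that tree_acyclic[OF U, of v w w'] unfolding adj by blast
  qed
qed

lemma core_tree_core_otree:
  assumes "core_tree G" shows "core_otree (pverts G) (parcs G)"
proof -
  interpret otree "pverts G" "parcs G" using oriented_tree_otree assms by (auto simp: core_tree_def)
  show ?thesis
  proof
    fix h assume "\<And>x. x \<in> pverts G \<Longrightarrow> h x \<in> pverts G" "\<And>x y. (x, y) \<in> parcs G \<Longrightarrow> (h x, h y) \<in> parcs G"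
    then show "inj_on h (pverts G)"
      using assms by (simp add: core_tree_def core_digraph_def digraph_hom_def)
  qed
qed

lemma has_majority_if_majority3:
  assumes "otree (pverts G) (parcs G)" "otree.majority3 (pverts G) (parcs G) F"
  shows "has_majority G"
proof -
  interpret otree "pverts G" "parcs G" by fact
  have F: "\<And>x y z. x \<in> pverts G \<Longrightarrow> y \<in> pverts G \<Longrightarrow> z \<in> pverts G \<Longrightarrow> F x y z \<in> pverts G"
    "\<And>x y z x' y' z'. (x, x') \<in> parcs G \<Longrightarrow> (y, y') \<in> parcs G \<Longrightarrow> (z, z') \<in> parcs G \<Longrightarrow>
       (F x y z, F x' y' z') \<in> parcs G"
    "\<And>x y. x \<in> pverts G \<Longrightarrow> y \<in> pverts G \<Longrightarrow> F x x y = x \<and> F x y x = x \<and> F y x x = x"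
    using assms(2) unfolding majority3_def by blast+
  have "majority_polymorphism G (\<lambda>us. F (us ! 0) (us ! 1) (us ! 2))"
    unfolding majority_polymorphism_def polymorphism_def
  proof (intro conjI allI ballI impI)
    fix us :: "'a list" assume "length us = 3 \<and> set us \<subseteq> pverts G"
    then have "us ! 0 \<in> pverts G" "us ! 1 \<in> pverts G" "us ! 2 \<in> pverts G"
      by (auto simp: subset_code(1))
    then show "F (us ! 0) (us ! 1) (us ! 2) \<in> pverts G" using F(1) by blast
  next
    fix us vs :: "'a list" assume "length us = 3 \<and> length vs = 3 \<and> (\<forall>i<3. (us ! i, vs ! i) \<in> parcs G)"
    then show "(F (us ! 0) (us ! 1) (us ! 2), F (vs ! 0) (vs ! 1) (vs ! 2)) \<in> parcs G" using F(2) by simp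
  qed (use F(3) in auto)
  then show ?thesis unfolding has_majority_def by blast
qed

text \<open>Both compositions of the homomorphisms are injective; counting vertices and arcs does the rest.\<close>

lemma hom_equivalent_cores_iso:
  assumes G: "core_otree (pverts G) (parcs G)" and H: "core_otree (pverts H) (parcs H)"
    and h: "digraph_hom h G H" and k: "digraph_hom k H G"
  shows "digraph_iso (with_proj G) (with_proj H)"
proof -
  interpret G: core_otree "pverts G" "parcs G" by fact
  interpret H: core_otree "pverts H" "parcs H" by fact
  have "inj_on (k \<circ> h) (pverts G)" by (rule G.core) (use h k in \<open>auto simp: digraph_hom_def\<close>)
  then have ih: "inj_on h (pverts G)" by (rule inj_on_imageI2)
  have "inj_on (h \<circ> k) (pverts H)" by (rule H.core) (use h k in \<open>auto simp: digraph_hom_def\<close>)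
  then have ik: "inj_on k (pverts H)" by (rule inj_on_imageI2)
  have hV: "h ` pverts G \<subseteq> pverts H" and kV: "k ` pverts H \<subseteq> pverts G" using h k by (auto simp: digraph_hom_def)
  have img: "h ` pverts G = pverts H"
    using card_inj_on_le[OF ik kV G.fin] card_image[OF ih] card_subset_eq[OF H.fin hV]
      card_mono[OF H.fin hV] by simp
  have fa: "finite (parcs G)" "finite (parcs H)"
    using finite_subset[OF G.AV] finite_subset[OF H.AV] G.fin H.fin by auto
  have iha: "inj_on (map_prod h h) (parcs G)"
    using inj_on_subset[OF map_prod_inj_on[OF ih ih] G.AV] .
  have ika: "inj_on (map_prod k k) (parcs H)"
    using inj_on_subset[OF map_prod_inj_on[OF ik ik] H.AV] .
  have hA: "map_prod h h ` parcs G \<subseteq> parcs H" and kA: "map_prod k k ` parcs H \<subseteq> parcs G"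
    using h k by (auto simp: digraph_hom_def)
  have imga: "map_prod h h ` parcs G = parcs H"
    using card_inj_on_le[OF ika kA fa(1)] card_image[OF iha] card_subset_eq[OF fa(2) hA]
      card_mono[OF fa(2) hA] by simp
  define f where "f = \<lparr>iso_verts = h, iso_arcs = map_prod h h, iso_head = snd, iso_tail = fst\<rparr>"
  have wf: "wf_digraph (with_proj G)"
    using G.AV by unfold_locales auto
  have "pre_digraph.digraph_isomorphism (with_proj G) f"
    unfolding pre_digraph.digraph_isomorphism_def using wf ih iha by (auto simp: f_def)
  moreover have "with_proj H = app_iso f (with_proj G)"
    using img imga by (simp add: app_iso_def f_def with_proj_def)
  ultimately show ?thesis unfolding digraph_iso_def by blast
qed

section \<open>Trees given by parent functions\<close>

definition parent_tree :: "(nat \<Rightarrow> nat) \<Rightarrow> nat \<Rightarrow> nat pair_pre_digraph" where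
  "parent_tree p n = \<lparr>pverts = {..<n}, parcs = {(i, j). i < n \<and> j < n \<and> (0 < i \<and> j = p i \<or> 0 < j \<and> i = p j)}\<rparr>"

lemma pcas_nth:
  "pcas u c v \<Longrightarrow> c \<noteq> [] \<Longrightarrow> fst (c ! 0) = u \<and> snd (c ! (length c - 1)) = v \<and>
    (\<forall>i. Suc i < length c \<longrightarrow> snd (c ! i) = fst (c ! Suc i))"
proof (induction c arbitrary: u)
  case (Cons e es)
  show ?case
  proof (cases "es = []")
    case True then show ?thesis using Cons by auto
  next
    case False
    then have IH: "fst (es ! 0) = snd e" "snd (es ! (length es - 1)) = v"
      "\<forall>i. Suc i < length es \<longrightarrow> snd (es ! i) = fst (es ! Suc i)" using Cons by auto
    have "snd ((e # es) ! i) = fst ((e # es) ! Suc i)" if "Suc i < length (e # es)" for i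
      using that IH by (cases i) auto
    then show ?thesis using Cons.prems IH False by (auto simp: nth_Cons')
  qed
qed simp

lemma undirected_tree_parent_tree:
  assumes p: "\<And>i. 0 < i \<Longrightarrow> i < n \<Longrightarrow> p i < i" and n: "0 < n"
  shows "undirected_tree (parent_tree p n)"
proof -
  let ?U = "parent_tree p n"
  have pn: "p i \<noteq> i" "i \<noteq> p i" if "0 < i" "i < n" for i using p[OF that] by auto
  have pg: "pair_graph ?U"
  proof
    have "parcs ?U \<subseteq> {..<n} \<times> {..<n}" by (auto simp: parent_tree_def)
    then show "finite (parcs ?U)" using finite_subset by blast
    show "symmetric (with_proj ?U)" by (auto simp: symmetric_def sym_def parent_tree_def arcs_ends_def)
  qed (use pn in \<open>auto simp: parent_tree_def\<close>)
  interpret pair_graph ?U by fact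
  have r0: "0 \<rightarrow>\<^sup>*\<^bsub>with_proj ?U\<^esub> i" if "i < n" for i using that
  proof (induction i rule: less_induct)
    case (less i)
    show ?case
    proof (cases "i = 0")
      case True
      have "0 \<in> pverts ?U" using n by (simp add: parent_tree_def)
      then show ?thesis using True reachable_refl by simp
    next
      case False
      then have "0 \<rightarrow>\<^sup>*\<^bsub>with_proj ?U\<^esub> p i" using less p by fastforce
      moreover have "(p i, i) \<in> parcs ?U" using False less p[of i] by (auto simp: parent_tree_def)
      ultimately show ?thesis by (rule reachable_adj_trans) 
    qed
  qed
  have sc: "strongly_connected (with_proj ?U)"
  proof
    show "verts (with_proj ?U) \<noteq> {}" using n by (auto simp: parent_tree_def)
    fix u v assume "u \<in> verts (with_proj ?U)" "v \<in> verts (with_proj ?U)"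
    then have "0 \<rightarrow>\<^sup>*\<^bsub>with_proj ?U\<^esub> u" "0 \<rightarrow>\<^sup>*\<^bsub>with_proj ?U\<^esub> v" using r0 by (auto simp: parent_tree_def)
    then show "u \<rightarrow>\<^sup>*\<^bsub>with_proj ?U\<^esub> v"
      using symmetric_reachable[OF pair_sym_arcs] reachable_trans by blast
  qed
  have "connected (with_proj ?U)" 
    unfolding connected_def
  proof
    show "verts (mk_symmetric (with_proj ?U)) \<noteq> {}" using n by (auto simp: parent_tree_def)
    fix u v assume "u \<in> verts (mk_symmetric (with_proj ?U))" "v \<in> verts (mk_symmetric (with_proj ?U))"
    then show "u \<rightarrow>\<^sup>*\<^bsub>with_proj (mk_symmetric (with_proj ?U))\<^esub> v"
      using sc reachable_mk_symmetric_eq[OF pair_sym_arcs] by (simp add: strongly_connected_def)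
  qed
  moreover have False if c: "pre_digraph.cycle (with_proj ?U) c" "length c \<ge> 3" for c
  proof -
    obtain u where u: "awalk u c u" "distinct (tl (pawalk_verts u c))" using c by (auto simp: cycle_def)
    let ?k = "length c" and ?hs = "map snd c"
    have ca: "pcas u c u" "set c \<subseteq> parcs ?U" "c \<noteq> []" using u c by (auto simp: awalk_def)
    have dist: "distinct ?hs" using u(2) awalk_verts_conv'[OF ca(1)] ca(3) by simp
    note nx = pcas_nth[OF ca(1,3)]
    have "Max (set ?hs) \<in> set ?hs" using ca(3) by (intro Max_in) auto
    then obtain i where i: "i < ?k" "snd (c ! i) = Max (set ?hs)" by (auto simp: in_set_conv_nth)
    \<comment> \<open>Both neighbours of the largest vertex of the cycle would be its parent.\<close>
    define m where "m = Max (set ?hs)"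
    have le: "snd (c ! j) \<le> m" if "j < ?k" for j using that unfolding m_def by (intro Max_ge) auto
    define l where "l = (if i = 0 then ?k - 1 else i - 1)"
    define j where "j = (if i = ?k - 1 then 0 else i + 1)"
    have lj: "l < ?k" "j < ?k" "l \<noteq> j" using i(1) c(2) by (auto simp: l_def j_def split: if_splits)
    have fi: "fst (c ! i) = snd (c ! l)" using nx i(1) by (cases i) (auto simp: l_def)
    have fj: "fst (c ! j) = m" using nx i by (auto simp: j_def m_def)
    have A: "c ! i \<in> parcs ?U" "c ! j \<in> parcs ?U" using ca(2) i(1) lj(2) by auto
    have "snd (c ! l) = p m"
    proof -
      have "(snd (c ! l), m) \<in> parcs ?U" using A(1) fi i(2) by (metis m_def prod.collapse)
      then show ?thesis using le[OF lj(1)] p[of "snd (c ! l)"] by (auto simp: parent_tree_def)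
    qed
    moreover have "snd (c ! j) = p m"
    proof -
      have "(m, snd (c ! j)) \<in> parcs ?U" using A(2) fj by (metis prod.collapse)
      then show ?thesis using le[OF lj(2)] p[of "snd (c ! j)"] by (auto simp: parent_tree_def)
    qed
    ultimately have "?hs ! l = ?hs ! j" using lj by simp
    then show False using nth_eq_iff_index_eq[OF dist, of l j] lj by (simp del: nth_map)
  qed
  ultimately show ?thesis using pg unfolding undirected_tree_def by blast
qed

section \<open>The tree on 16 vertices and its reverse\<close>

definition base16 :: "(nat \<times> nat) list" where
  "base16 = [(1, 0), (2, 1), (1, 3), (3, 4), (4, 5), (0, 6), (7, 6), (8, 7), (7, 9), (9, 10),
     (11, 0), (11, 12), (12, 13), (13, 14), (14, 15)]"

definition arcs16 :: "bool \<Rightarrow> (nat \<times> nat) list" where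
  "arcs16 e = (if e then base16 else map prod.swap base16)"

text \<open>The centre is \<open>0\<close>; the arms consist of the vertices 1 to 5, 6 to 10 and 11
  to 15, with top vertices 1, 6 and 11.\<close>

definition tree16 :: "bool \<Rightarrow> nat pair_pre_digraph" where
  "tree16 e = \<lparr>pverts = {..<16}, parcs = set (arcs16 e)\<rparr>"

definition parent16 :: "nat \<Rightarrow> nat" where
  "parent16 i = [0, 0, 1, 1, 3, 4, 0, 6, 7, 7, 9, 0, 11, 12, 13, 14] ! i"

lemma oriented_tree_tree16: "oriented_tree (tree16 e)"
proof -
  have par: "parent16 i < i" if "0 < i" "i < 16" for i
  proof -
    have "\<forall>i\<in>set [1..<16]. parent16 i < i" by code_simp
    then show ?thesis using that by simp
  qed
  have U: "undirected_tree (parent_tree parent16 16)"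
    by (rule undirected_tree_parent_tree) (use par in auto)
  have P: "\<forall>(x, y)\<in>set (arcs16 e). x < 16 \<and> y < 16 \<and> (0 < x \<and> y = parent16 x \<or> 0 < y \<and> x = parent16 y)"
    by (induct e rule: bool.induct; code_simp)
  have Q: "\<forall>i\<in>set [1..<16]. ((i, parent16 i) \<in> set (arcs16 e)) = ((parent16 i, i) \<notin> set (arcs16 e))"
    by (induct e rule: bool.induct; code_simp)
  have "orientation_of (tree16 e) (parent_tree parent16 16)"
    unfolding orientation_of_def
  proof (intro conjI allI impI)
    show "pverts (tree16 e) = pverts (parent_tree parent16 16)" by (simp add: tree16_def parent_tree_def)
    show "parcs (tree16 e) \<subseteq> parcs (parent_tree parent16 16)"
      using P by (auto simp: tree16_def parent_tree_def)
    fix x y assume "(x, y) \<in> parcs (parent_tree parent16 16)"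
    then have "x < 16" "y < 16" "0 < x \<and> y = parent16 x \<or> 0 < y \<and> x = parent16 y"
      by (auto simp: parent_tree_def)
    then show "((x, y) \<in> parcs (tree16 e)) = ((y, x) \<notin> parcs (tree16 e))"
      using Q unfolding tree16_def by auto
  qed
  then show ?thesis using U unfolding oriented_tree_def by blast
qed

lemma arcs16_True: "arcs16 True = [(1, 0), (2, 1), (1, 3), (3, 4), (4, 5), (0, 6), (7, 6), (8, 7), (7, 9),
    (9, 10), (11, 0), (11, 12), (12, 13), (13, 14), (14, 15)]"
  by (simp add: arcs16_def base16_def)

lemma arcs16_iff: "(x, y) \<in> set (arcs16 e) \<longleftrightarrow> (if e then (x, y) \<in> set base16 else (y, x) \<in> set base16)"
  by (force simp: arcs16_def image_iff)

text \<open>The two longest directed paths serve as anchors for homomorphisms, both in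
  \<open>rigid16\<close> and in \<open>no_hom_tree16\<close>.\<close>

lemma directed_path4:
  assumes "(a, b) \<in> set (arcs16 True)" "(b, c) \<in> set (arcs16 True)" "(c, d) \<in> set (arcs16 True)"
    "(d, f) \<in> set (arcs16 True)"
  shows "a = 11 \<and> b = 12 \<and> c = 13 \<and> d = 14 \<and> f = 15 \<or> a = 2 \<and> b = 1 \<and> c = 3 \<and> d = 4 \<and> f = 5"
proof -
  have d: "d \<in> {0, 1, 2, 3, 4, 7, 8, 9, 11, 12, 13, 14}" using assms(4) by (auto simp: arcs16_True)
  have c: "c \<in> {1, 2, 3, 7, 8, 11, 12, 13}" using assms(3) d by (auto simp: arcs16_True)
  have b: "b \<in> {1, 2, 8, 11, 12}" using assms(2) c by (auto simp: arcs16_True)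
  have ab: "a = 2 \<and> b = 1 \<or> a = 11 \<and> b = 12" using assms(1) b by (auto simp: arcs16_True)
  then show ?thesis
  proof (elim disjE conjE)
    assume e: "a = 2" "b = 1"
    have 3: "c = 3" using assms(2) c unfolding e by (auto simp: arcs16_True)
    have 4: "d = 4" using assms(3) unfolding 3 by (auto simp: arcs16_True)
    show ?thesis using assms(4) e 3 unfolding 4 by (auto simp: arcs16_True)
  next
    assume e: "a = 11" "b = 12"
    have 3: "c = 13" using assms(2) unfolding e by (auto simp: arcs16_True)
    have 4: "d = 14" using assms(3) unfolding 3 by (auto simp: arcs16_True)
    show ?thesis using assms(4) e 3 unfolding 4 by (auto simp: arcs16_True)
  qed
qed

text \<open>The path from 11 to 15 can only go to itself or to the path from 2 to 5, and the latter
  would require a predecessor of the source 2. Once this path is fixed, so is 0, and the other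
  vertices follow outwards from it.\<close>

lemma rigid16:
  assumes h: "\<And>x y. (x, y) \<in> set (arcs16 True) \<Longrightarrow> (h x, h y) \<in> set (arcs16 True)"
  shows "x < 16 \<Longrightarrow> h x = x"
proof -
  let ?A = "set (arcs16 True)"
  have a: "(h 1, h 0) \<in> ?A" "(h 2, h 1) \<in> ?A" "(h 1, h 3) \<in> ?A" "(h 3, h 4) \<in> ?A" "(h 4, h 5) \<in> ?A"
    "(h 0, h 6) \<in> ?A" "(h 7, h 6) \<in> ?A" "(h 8, h 7) \<in> ?A" "(h 7, h 9) \<in> ?A" "(h 9, h 10) \<in> ?A"
    "(h 11, h 0) \<in> ?A" "(h 11, h 12) \<in> ?A" "(h 12, h 13) \<in> ?A" "(h 13, h 14) \<in> ?A" "(h 14, h 15) \<in> ?A"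
    by (rule h, simp add: arcs16_True)+
  have "h 11 \<noteq> 2"
  proof
    assume "h 11 = 2"
    then have "h 0 = 1" using a(11) by (auto simp: arcs16_True)
    then have "h 1 = 2" using a(1) by (auto simp: arcs16_True)
    then show False using a(2) by (auto simp: arcs16_True)
  qed
  then have p: "h 11 = 11" "h 12 = 12" "h 13 = 13" "h 14 = 14" "h 15 = 15"
    using directed_path4[OF a(12-15)] by auto
  have "h 0 \<noteq> 12"
  proof
    assume "h 0 = 12"
    then have "h 1 = 11" using a(1) by (auto simp: arcs16_True)
    then show False using a(2) by (auto simp: arcs16_True)
  qed
  then have 0: "h 0 = 0" using a(11) p by (auto simp: arcs16_True)
  have "h 1 \<noteq> 11" using a(2) by (auto simp: arcs16_True)
  then have 1: "h 1 = 1" using a(1) 0 by (auto simp: arcs16_True)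
  have 2: "h 2 = 2" using a(2) 1 by (auto simp: arcs16_True)
  have "h 3 \<noteq> 0"
  proof
    assume "h 3 = 0"
    then have "h 4 = 6" using a(4) by (auto simp: arcs16_True)
    then show False using a(5) by (auto simp: arcs16_True)
  qed
  then have 3: "h 3 = 3" using a(3) 1 by (auto simp: arcs16_True)
  have 4: "h 4 = 4" using a(4) 3 by (auto simp: arcs16_True)
  have 5: "h 5 = 5" using a(5) 4 by (auto simp: arcs16_True)
  have 6: "h 6 = 6" using a(6) 0 by (auto simp: arcs16_True)
  have "h 7 \<noteq> 0"
  proof
    assume "h 7 = 0"
    then have "h 9 = 6" using a(9) by (auto simp: arcs16_True)
    then show False using a(10) by (auto simp: arcs16_True)
  qed
  then have 7: "h 7 = 7" using a(7) 6 by (auto simp: arcs16_True)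
  have 8: "h 8 = 8" using a(8) 7 by (auto simp: arcs16_True)
  have "h 9 \<noteq> 6" using a(10) by (auto simp: arcs16_True)
  then have 9: "h 9 = 9" using a(9) 7 by (auto simp: arcs16_True)
  have 10: "h 10 = 10" using a(10) 9 by (auto simp: arcs16_True)
  assume "x < 16"
  then have "x = 0 \<or> x = 1 \<or> x = 2 \<or> x = 3 \<or> x = 4 \<or> x = 5 \<or> x = 6 \<or> x = 7 \<or> x = 8 \<or> x = 9 \<or> x = 10 \<or> x = 11 \<or> x = 12 \<or> x = 13 \<or> x = 14 \<or> x = 15"
    by arith
  then show "h x = x" by (elim disjE) (simp_all only: 0 1 2 3 4 5 6 7 8 9 10 p)
qed

lemma core_tree_tree16: "core_tree (tree16 e)"
proof -
  have "inj_on h (pverts (tree16 e))" if "digraph_hom h (tree16 e) (tree16 e)" for h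
  proof -
    have "(h x, h y) \<in> set (arcs16 True)" if "(x, y) \<in> set (arcs16 True)" for x y
      using \<open>digraph_hom h _ _\<close> that
      by (cases e) (auto simp: digraph_hom_def tree16_def arcs16_iff)
    then have "h x = x" if "x < 16" for x using rigid16 that by blast
    then show ?thesis by (auto simp: tree16_def inj_on_def)
  qed
  then show ?thesis using oriented_tree_tree16 by (simp add: core_tree_def core_digraph_def)
qed

text \<open>Reversal sends 11 to the last vertex of a longest path. Then \<open>h 0\<close> is the
  vertex before it, whose only successor is a sink, so \<open>h 1\<close> has no successor left for
  \<open>h 2\<close>.\<close>

lemma no_hom_tree16: "\<not> digraph_hom h (tree16 True) (tree16 False)"
proof
  assume h: "digraph_hom h (tree16 True) (tree16 False)"
  let ?A = "set (arcs16 True)"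
  have "(h y, h x) \<in> ?A" if "(x, y) \<in> ?A" for x y
    using h that by (auto simp: digraph_hom_def tree16_def arcs16_iff)
  note hh = this
  have a: "(h 0, h 11) \<in> ?A" "(h 12, h 11) \<in> ?A" "(h 13, h 12) \<in> ?A" "(h 14, h 13) \<in> ?A"
    "(h 15, h 14) \<in> ?A" "(h 0, h 1) \<in> ?A" "(h 1, h 2) \<in> ?A"
    by (rule hh, simp add: arcs16_True)+
  have False if "h 11 = u" "\<And>v. (v, u) \<in> ?A \<Longrightarrow> (v, h 1) \<in> ?A \<Longrightarrow> (h 1, h 2) \<notin> ?A" for u
    using that a(1,6,7) by blast
  moreover have "h 11 = 15 \<or> h 11 = 5" using directed_path4[OF a(5,4,3,2)] by blast
  moreover have "(h 1, h 2) \<notin> ?A" if "(v, 15) \<in> ?A" "(v, h 1) \<in> ?A" for v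
  proof -
    have "v = 14" using that(1) by (auto simp: arcs16_True)
    then have "h 1 = 15" using that(2) by (auto simp: arcs16_True)
    then show ?thesis by (auto simp: arcs16_True)
  qed
  moreover have "(h 1, h 2) \<notin> ?A" if "(v, 5) \<in> ?A" "(v, h 1) \<in> ?A" for v
  proof -
    have "v = 4" using that(1) by (auto simp: arcs16_True)
    then have "h 1 = 5" using that(2) by (auto simp: arcs16_True)
    then show ?thesis by (auto simp: arcs16_True)
  qed
  ultimately show False by blast
qed

lemma not_iso_tree16: "\<not> digraph_iso (with_proj (tree16 True)) (with_proj (tree16 False))"
proof
  assume "digraph_iso (with_proj (tree16 True)) (with_proj (tree16 False))"
  then obtain f where f: "pre_digraph.digraph_isomorphism (with_proj (tree16 True)) f"
    "with_proj (tree16 False) = app_iso f (with_proj (tree16 True))" by (auto simp: digraph_iso_def)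
  have V: "pverts (tree16 False) = iso_verts f ` pverts (tree16 True)"
    and A: "parcs (tree16 False) = iso_arcs f ` parcs (tree16 True)"
    and t: "iso_tail f = fst" and h: "iso_head f = snd"
    using f(2) by (auto simp: with_proj_def app_iso_def)
  have "(iso_verts f x, iso_verts f y) \<in> parcs (tree16 False)" if "(x, y) \<in> parcs (tree16 True)" for x y
  proof -
    have "iso_verts f x = fst (iso_arcs f (x, y))" "iso_verts f y = snd (iso_arcs f (x, y))"
      using f(1) that t h unfolding pre_digraph.digraph_isomorphism_def by auto
    then show ?thesis using A that by auto
  qed
  then have "digraph_hom (iso_verts f) (tree16 True) (tree16 False)"
    using V unfolding digraph_hom_def by blast
  then show False using no_hom_tree16 by blast
qed

text \<open>A digraph and its reverse have the same majority polymorphisms, so one computation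
  covers both values of \<open>e\<close>: the majority values force further ones along arcs until a
  triple with a successor receives the sink 6.\<close>

lemma no_majority_tree16: "\<not> has_majority (tree16 e)"
proof
  assume "has_majority (tree16 e)"
  then obtain f where f: "majority_polymorphism (tree16 e) f" by (auto simp: has_majority_def)
  define F where "F x y z = f [x, y, z]" for x y z
  let ?A = "set (arcs16 True)"
  have st: "(F x y z, F x' y' z') \<in> ?A" if "(x, x') \<in> ?A" "(y, y') \<in> ?A" "(z, z') \<in> ?A" for x y z x' y' z'
  proof -
    have p: "(f us, f vs) \<in> parcs (tree16 e)"
      if "length us = 3" "length vs = 3" "\<forall>i<3. (us ! i, vs ! i) \<in> parcs (tree16 e)" for us vs
      using f that unfolding majority_polymorphism_def polymorphism_def by blast
    show ?thesis
    proof (cases e)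
      case True
      then show ?thesis using p[of "[x, y, z]" "[x', y', z']"] that
        by (auto simp: F_def tree16_def arcs16_iff less_Suc_eq numeral_3_eq_3)
    next
      case False
      then show ?thesis using p[of "[x', y', z']" "[x, y, z]"] that
        by (auto simp: F_def tree16_def arcs16_iff less_Suc_eq numeral_3_eq_3)
    qed
  qed
  have mj: "F x x y = x" "F x y x = x" "F y x x = x" if "x < 16" "y < 16" for x y
    using f that unfolding majority_polymorphism_def by (auto simp: F_def tree16_def)
  \<comment> \<open>The triples \<open>1, 1, 11\<close> and \<open>11, 1, 11\<close> have majority
    values 1 and 11 and both precede \<open>0, 3, 12\<close>; the only common successor of 1 and 11
    is 0.\<close>
  have "(1, F 0 3 12) \<in> ?A" using st[of 1 0 1 3 11 12] mj[of 1 11] by (simp add: arcs16_True)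
  moreover have "(11, F 0 3 12) \<in> ?A" using st[of 11 0 1 3 11 12] mj[of 11 1] by (simp add: arcs16_True)
  ultimately have 1: "F 0 3 12 = 0" by (auto simp: arcs16_True)
  have "(F 0 3 12, F 6 4 13) \<in> ?A" using st[of 0 6 3 4 12 13] by (simp add: arcs16_True)
  then have "F 6 4 13 = 6" using 1 by (auto simp: arcs16_True)
  moreover have "(F 7 3 12, F 6 4 13) \<in> ?A" using st[of 7 6 3 4 12 13] by (simp add: arcs16_True)
  ultimately have 2: "F 7 3 12 = 0 \<or> F 7 3 12 = 7" by (auto simp: arcs16_True)
  \<comment> \<open>The triple \<open>7, 0, 0\<close> has value 0, so its predecessor
    \<open>8, 1, 11\<close> gets 1 or 11. Neither has an arc to 7, which rules out the value 7 for
    \<open>F 7 3 12\<close>.\<close>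
  have "(F 8 1 11, 0) \<in> ?A" using st[of 8 7 1 0 11 0] mj[of 0 7] by (simp add: arcs16_True)
  then have "F 8 1 11 = 1 \<or> F 8 1 11 = 11" by (auto simp: arcs16_True)
  moreover have "(F 8 1 11, F 7 3 12) \<in> ?A" using st[of 8 7 1 3 11 12] by (simp add: arcs16_True)
  ultimately have "F 7 3 12 = 0" using 2 by (auto simp: arcs16_True)
  moreover have "(F 7 3 12, F 9 4 13) \<in> ?A" using st[of 7 9 3 4 12 13] by (simp add: arcs16_True)
  ultimately have "F 9 4 13 = 6" by (auto simp: arcs16_True)
  moreover have "(F 9 4 13, F 10 5 14) \<in> ?A" using st[of 9 10 4 5 13 14] by (simp add: arcs16_True)
  ultimately show False by (auto simp: arcs16_True)
qed

lemma nb_tree16: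
  assumes "otree (pverts (tree16 e)) (parcs (tree16 e))"
  shows "otree.nb (parcs (tree16 e)) w = {u. (w, u) \<in> set (arcs16 True) \<or> (u, w) \<in> set (arcs16 True)}"
  using otree.nb_def[OF assms] by (cases e) (auto simp: adjr_def tree16_def arcs16_iff)

lemma brs_tree16:
  assumes "otree (pverts (tree16 e)) (parcs (tree16 e))"
  shows "otree.brs (parcs (tree16 e)) 0 (otree.nb (parcs (tree16 e)) 0) (hd (exceptional e))"
proof -
  interpret otree "pverts (tree16 e)" "parcs (tree16 e)" by fact
  have nb: "nb 0 = {1, 6, 11}" "nb 1 = {0, 2, 3}" "nb 2 = {1}" "nb 3 = {1, 4}" "nb 4 = {3, 5}" "nb 5 = {4}"
    "nb 6 = {0, 7}" "nb 7 = {6, 8, 9}" "nb 8 = {7}" "nb 9 = {7, 10}" "nb 10 = {9}" "nb 11 = {0, 12}"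
    "nb 12 = {11, 13}" "nb 13 = {12, 14}" "nb 14 = {13, 15}" "nb 15 = {14}"
    unfolding nb_tree16[OF assms] arcs16_True by auto
  show ?thesis
  proof (cases e)
    case True
    have X: "hd (exceptional e) = star3 (True, B False (B False E (B True (B True E E) E)) E)
       (False, B False E (B True (B True (B True E E) E) E)) (False, B True (B True (B True (B True E E) E) E) E)"
      using True by (simp add: exceptional_def)
    have p: "(x, y) \<in> parcs (tree16 e) \<longleftrightarrow> (x, y) \<in> set (arcs16 True)" for x y
      using True by (simp add: tree16_def)
    show ?thesis unfolding X by (simp add: star3_def nb nb(2)[unfolded One_nat_def] p dr_def arcs16_True insert_Diff_if)
  next
    case False
    have X: "hd (exceptional e) = star3 (True, B True E (B False (B False (B False E E) E) E))
       (True, B False (B False (B False (B False E E) E) E) E) (False, B True (B True E (B False (B False E E) E)) E)"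
      using False by (simp add: exceptional_def)
    have p: "(x, y) \<in> parcs (tree16 e) \<longleftrightarrow> (y, x) \<in> set (arcs16 True)" for x y
      using False by (simp add: tree16_def arcs16_iff)
    show ?thesis unfolding X by (simp add: star3_def nb nb(2)[unfolded One_nat_def] p dr_def arcs16_True insert_Diff_if)
  qed
qed

section \<open>The classification\<close>

lemma no_small_arms: "filter (arm1 e) (branches 3) = []" "filter (arm0 e) (branches 3) = []"
  by (induct e rule: bool.induct; code_simp)+

lemma arm1_triples_up: "trip3 (settled True) (filter (arm1 True) (branches 7))"
  by code_simp

lemma arm1_triples_down: "trip3 (settled False) (filter (arm1 False) (branches 7))"
  by code_simp

lemma arm0_triples_up: "trip3 settled0 (filter (arm0 True) (branches 7))"
  by code_simp

lemma arm0_triples_down: "trip3 settled0 (filter (arm0 False) (branches 7))"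
  by code_simp

text \<open>The same code describes \<open>T\<close> around \<open>c\<close> and
  \<open>tree16 e\<close> around \<open>0\<close>. Reading it through \<open>hom_lo\<close> once
  with each tree as the source gives the two homomorphisms required by
  \<open>hom_equivalent_cores_iso\<close>.\<close>

theorem no_majority_iso_tree16:
  assumes T: "core_tree T" "card (pverts T) \<le> 16" "\<not> has_majority T"
  shows "card (pverts T) = 16 \<and> (\<exists>e. digraph_iso (with_proj T) (with_proj (tree16 e)))"
proof -
  have ct: "core_otree (pverts T) (parcs T)" using T core_tree_core_otree by blast
  interpret T: core_otree "pverts T" "parcs T" by fact
  have "\<not> (\<exists>F. T.majority3 F)" using has_majority_if_majority3[OF T.otree_axioms] T(3) by blast
  moreover have "trip3 (settled e) (filter (arm1 e) (branches 7))" for e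
    using arm1_triples_up arm1_triples_down by (cases e) simp_all
  moreover have "trip3 settled0 (filter (arm0 e) (branches 7))" for e
    using arm0_triples_up arm0_triples_down by (cases e) simp_all
  ultimately obtain e c where c: "c \<in> pverts T" and b: "T.brs c (T.nb c) (hd (exceptional e))"
    and card: "card (pverts T) = 16"
    using T.exceptional_if_no_majority T(2) no_small_arms by blast
  have ch: "core_otree (pverts (tree16 e)) (parcs (tree16 e))" using core_tree_tree16 core_tree_core_otree by blast
  interpret H: core_otree "pverts (tree16 e)" "parcs (tree16 e)" by fact
  have bH: "H.brs 0 (H.nb 0) (hd (exceptional e))" using brs_tree16 H.otree_axioms by blast
  have zero: "0 \<in> pverts (tree16 e)" by (simp add: tree16_def)
  obtain h where "\<forall>x\<in>T.U c (T.nb c). h x \<in> pverts (tree16 e)"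
    "\<forall>x\<in>T.U c (T.nb c). \<forall>y\<in>T.U c (T.nb c). (x, y) \<in> parcs T \<longrightarrow> (h x, h y) \<in> parcs (tree16 e)"
    using T.hom_lo[OF b subset_refl H.brs_lo[OF bH] zero H.AV] by blast
  then have "digraph_hom h T (tree16 e)"
    using T.V_decomp[OF c] T.AV unfolding digraph_hom_def by blast
  moreover obtain k where "\<forall>x\<in>H.U 0 (H.nb 0). k x \<in> pverts T"
    "\<forall>x\<in>H.U 0 (H.nb 0). \<forall>y\<in>H.U 0 (H.nb 0). (x, y) \<in> parcs (tree16 e) \<longrightarrow> (k x, k y) \<in> parcs T"
    using H.hom_lo[OF bH subset_refl T.brs_lo[OF b] c T.AV] by blast
  then have "digraph_hom k (tree16 e) T"
    using H.V_decomp[OF zero] H.AV unfolding digraph_hom_def by blast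
  ultimately show ?thesis using hom_equivalent_cores_iso[OF ct ch] card by blast
qed

theorem mainTheorem9:
  shows "(\<exists>(T\<^sub>1 :: nat pair_pre_digraph) (T\<^sub>2 :: nat pair_pre_digraph).
            core_tree T\<^sub>1 \<and> card (pverts T\<^sub>1) = 16 \<and> \<not> has_majority T\<^sub>1 \<and>
            core_tree T\<^sub>2 \<and> card (pverts T\<^sub>2) = 16 \<and> \<not> has_majority T\<^sub>2 \<and>
            \<not> digraph_iso (with_proj T\<^sub>1) (with_proj T\<^sub>2) \<and>
            (\<forall>T :: 'a pair_pre_digraph.
               core_tree T \<and> card (pverts T) = 16 \<and> \<not> has_majority T \<longrightarrow>
               digraph_iso (with_proj T) (with_proj T\<^sub>1) \<or>
               digraph_iso (with_proj T) (with_proj T\<^sub>2))) \<and>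
         (\<forall>T :: 'a pair_pre_digraph.
            core_tree T \<and> card (pverts T) < 16 \<longrightarrow> has_majority T)"
proof -
  have A: "\<forall>T :: 'a pair_pre_digraph. core_tree T \<and> card (pverts T) = 16 \<and> \<not> has_majority T \<longrightarrow>
      digraph_iso (with_proj T) (with_proj (tree16 True)) \<or>
      digraph_iso (with_proj T) (with_proj (tree16 False))"
  proof (intro allI impI)
    fix T :: "'a pair_pre_digraph"
    assume "core_tree T \<and> card (pverts T) = 16 \<and> \<not> has_majority T"
    then obtain e where "digraph_iso (with_proj T) (with_proj (tree16 e))"
      using no_majority_iso_tree16[of T] by auto
    then show "digraph_iso (with_proj T) (with_proj (tree16 True)) \<or>
      digraph_iso (with_proj T) (with_proj (tree16 False))" by (cases e) simp_all
  qed
  have B: "\<forall>T :: 'a pair_pre_digraph. core_tree T \<and> card (pverts T) < 16 \<longrightarrow> has_majority T"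
    using no_majority_iso_tree16 by fastforce
  have C: "card (pverts (tree16 e)) = 16" for e by (simp add: tree16_def)
  show ?thesis
    by (rule conjI, rule exI[of _ "tree16 True"], rule exI[of _ "tree16 False"], intro conjI)
      (rule core_tree_tree16 C no_majority_tree16 not_iso_tree16 A B)+
qed

end
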